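(* Let $p\ge 1$ and $k>0$ be fixed integers. Consider the uniform probability $P^{Np+k,p}$ on words $\pi$ of length $Np+k$ from the alphabet $\{1,\ldots,p\}$, and also the induced measure on partitions $\lambda$ (the RSK shapes). Then $$\lim_{N\to\infty}N^{\frac{p^2-1}{2}}P^{Np+k,p}(\lambda_p\ge N)=\lim_{N\to\infty}N^{\frac{p^2-1}{2}}P^{Np+k,p}\big(d_1(\pi)=p\ \text{ and }\ i_{p-1}(\pi)\le N(p-1)+k\big)$$ $$=\frac{\sqrt p\,\prod_{j=1}^p(p-j)!}{(\sqrt{2\pi})^{p-1}\,k!}\;E\Big(\big(\tfrac12 Z_{2p^2}\big)^k\Big),$$ where $Z_{2p^2}$ is a chi-square random variable of parameter $2p^2$. Thus, as $N\to\infty$, $$P^{Np+k,p}\big(d_1(\pi)=p\ \text{ and }\ i_{p-1}(\pi)\le N(p-1)+k\big)\simeq \frac{\sqrt p\,\prod_{j=1}^p(p-j)!}{(\sqrt{2\pi})^{p-1}}\binom{p^2-1+k}{k}\Big(\frac1N\Big)^{\frac{p^2-1}{2}},$$ where $\simeq$ means that the ratio of the two sides tends to $1$.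
   Context: Words: $S_\ell^p$ is the set of $p^\ell$ words of length $\ell$ in the alphabet $\{1,\ldots,p\}$, with the uniform probability $P^{\ell,p}(\pi)=p^{-\ell}$. For a word $\pi$: $d_1(\pi)$ is the length of the longest strictly decreasing subsequence of $\pi$; $i_k(\pi)$ is the maximal length of a subsequence of $\pi$ that can be written as a disjoint union of $k$ weakly increasing subsequences of $\pi$ (with $i_0(\pi)=0$). Partitions: the RSK correspondence (words $\leftrightarrow$ pairs consisting of a semi-standard and a standard tableau of the same shape $\lambda$) pushes the uniform measure forward to the measure on partitions $\lambda$ of weight $\ell$ given by $P^{\ell,p}(\lambda)=f^\lambda\,\mathbf s_\lambda(1^p)/p^\ell$, where $f^\lambda$ is the number of standard tableaux of shape $\lambda$ and $\mathbf s_\lambda(1^p)$ is the number of semi-standard tableaux of shape $\lambda$ with entries in $\{1,\ldots,p\}$. The same symbol $P^{\ell,p}$ is used for both measures. $\lambda_p$ is the $p$-th part of $\lambda$ (zero if $\lambda$ has fewer than $p$ parts). The chi-square distribution of parameter $m$ is the law of $Z_m=\sum_{i=1}^m X_i^2$ with $X_1,\dots,X_m$ independent standard normal $N(0,1)$ random variables. *)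

theory Defs
  imports "HOL-Probability.Probability"
begin

definition words :: "nat \<Rightarrow> nat \<Rightarrow> nat list set" where
  "words l p = {w. length w = l \<and> set w \<subseteq> {1..p}}"

definition word_pmf :: "nat \<Rightarrow> nat \<Rightarrow> nat list pmf" where
  "word_pmf l p = pmf_of_set (words l p)"

lemma finite_words: "finite (words l p)"
  using finite_lists_length_eq[of "{1..p}" l] by (simp add: words_def conj_commute)

lemma card_words: "card (words l p) = p ^ l"
  using card_lists_length_eq[of "{1..p}" l] by (simp add: words_def conj_commute)

lemma pmf_word_pmf:
  assumes "w \<in> words l p"
  shows "pmf (word_pmf l p) w = 1 / real p ^ l"
proof -
  have "words l p \<noteq> {}" using assms by blast
  then show ?thesis
    using assms by (simp add: word_pmf_def pmf_of_set finite_words card_words)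
qed

text \<open>A subsequence of a word \<open>w\<close> is given by its set of positions \<open>I \<subseteq> {..<length w}\<close>, so that
  disjointness of subsequences means disjointness of the position sets.  In \<open>incr_len\<close> (the
  functional \<open>i_k\<close>) some of the \<open>k\<close> weakly increasing pieces may be empty.\<close>

definition decr_len :: "nat list \<Rightarrow> nat" where
  "decr_len w = Max {card I | I. I \<subseteq> {..<length w} \<and> sorted_wrt (>) (nths w I)}"

definition incr_len :: "nat \<Rightarrow> nat list \<Rightarrow> nat" where
  "incr_len k w = Max {card I | I. I \<subseteq> {..<length w} \<and>
     (\<exists>J. I = (\<Union>j<k. J j) \<and> disjoint_family_on J {..<k} \<and> (\<forall>j<k. sorted (nths w (J j))))}"

text \<open>Schensted row insertion: \<open>x\<close> replaces the leftmost entry strictly larger than \<open>x\<close>, which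
  is bumped into the next row, or is appended if there is no such entry.  Tableaux are lists of
  rows, the first row on top; rows are weakly increasing, columns strictly increasing.\<close>

fun row_insert :: "nat \<Rightarrow> nat list \<Rightarrow> nat option \<times> nat list" where
  "row_insert x [] = (None, [x])"
| "row_insert x (y # ys) =
     (if x < y then (Some y, x # ys)
      else (case row_insert x ys of (b, zs) \<Rightarrow> (b, y # zs)))"

fun tableau_insert :: "nat \<Rightarrow> nat list list \<Rightarrow> nat list list" where
  "tableau_insert x [] = [[x]]"
| "tableau_insert x (r # t) =
     (case row_insert x r of
        (None, r') \<Rightarrow> r' # t
      | (Some y, r') \<Rightarrow> r' # tableau_insert y t)"

definition rsk_tableau :: "nat list \<Rightarrow> nat list list" where
  "rsk_tableau w = fold tableau_insert w []"

text \<open>The common shape of the two tableaux attached to \<open>w\<close> by the RSK correspondence; it can be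
  read off from the semi-standard insertion tableau alone, so the standard recording tableau is
  not constructed.  A partition is the list of its positive parts.\<close>

definition rsk_shape :: "nat list \<Rightarrow> nat list" where
  "rsk_shape w = map length (rsk_tableau w)"

definition shape_part :: "nat list \<Rightarrow> nat \<Rightarrow> nat" where
  "shape_part mu i = (if 1 \<le> i \<and> i \<le> length mu then mu ! (i - 1) else 0)"

definition shape_pmf :: "nat \<Rightarrow> nat \<Rightarrow> nat list pmf" where
  "shape_pmf l p = map_pmf rsk_shape (word_pmf l p)"

text \<open>The law of \<open>X\<^sub>1\<^sup>2 + \<dots> + X\<^sub>m\<^sup>2\<close>, where the \<open>X\<^sub>i\<close> are independent standard normal variables,
  realised as the coordinates of a product of \<open>m\<close> copies of the standard normal distribution.\<close>

definition chi_square :: "nat \<Rightarrow> real measure" where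
  "chi_square m =
     distr (Pi\<^sub>M {..<m} (\<lambda>_. density lborel std_normal_density)) borel (\<lambda>x. \<Sum>i<m. (x i)\<^sup>2)"

end

theory Submission
  imports Defs "Jordan_Normal_Form.Determinant" "HOL-Real_Asymp.Real_Asymp"
begin

text \<open>By RSK, the number of words of length \<open>n\<close> and shape \<open>\<nu>\<close> is
  \<open>f\<^sup>\<nu> s\<^sub>\<nu>(1\<^sup>p)\<close>. The factor \<open>s\<^sub>\<nu>(1\<^sup>p)\<close> is the determinant of the binomial coefficients
  of the shifted parts, and
  \<open>f\<^sup>\<nu> = n! \<Prod>\<^sub>j j! s\<^sub>\<nu>(1\<^sup>p) / \<Prod>\<^sub>i (\<nu>\<^sub>i + p - 1 - i)!\<close>. A shape of \<open>N p + k\<close> boxes with last part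
  at least \<open>N\<close> is a partition \<open>\<mu>\<close> of \<open>k\<close> put behind an \<open>N\<close> times \<open>p\<close> rectangle, which does not change
  \<open>s\<^sub>\<mu>(1\<^sup>p)\<close>. Stirling's formula thus reduces the limit to the sum of \<open>s\<^sub>\<mu>(1\<^sup>p)\<^sup>2\<close> over all
  partitions \<open>\<mu>\<close> of \<open>k\<close>. The weighted sums of \<open>s\<^sub>\<nu>(1\<^sup>p)\<close> over all ways to add or to remove a box
  of \<open>\<mu>\<close> are multiples of \<open>s\<^sub>\<mu>(1\<^sup>p)\<close>, and this determines the sum of squares by induction on \<open>k\<close>.

  The last part of the shape is also the maximal number of disjoint subsequences \<open>p, p - 1, \<dots>, 1\<close>
  of the word. This number is computed by a process that respects the Knuth relations, and by
  duality it is the length of the word minus the maximal size of a union of \<open>p - 1\<close> weakly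
  increasing subsequences.\<close>

section \<open>Determinants of binomial coefficients\<close>

text \<open>The determinant is the Vandermonde product of the shifted parts divided by
  \<open>\<Prod>j<p. fact j\<close>, that is, Weyl's dimension formula. It is kept in expanded form
  because moving one box is then a single binomial identity in each permutation term. RSK is used as
  a count: every Gelfand-Tsetlin pattern of shape \<nu> comes from the same number of words, since
  each removable corner determines exactly one reverse insertion. On patterns, insertion acts level
  by level and can be reversed by induction on the alphabet. The sum of squares is the coefficient
  of t^k in (1 - t)^(-p^2), by Cauchy's identity. Multiplied by \<open>fact k\<close> it is the
  rising factorial of p^2, which is the k-th moment of half a chi-square variable of parameter 2
  p^2. The exponent (p^2 - 1)/2 is p(p - 1)/2 from the shifts of the parts plus (p - 1)/2 from the
  square roots in Stirling's formula.\<close>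

definition binomial_det :: "nat \<Rightarrow> (nat \<Rightarrow> nat) \<Rightarrow> real" where
  "binomial_det p l = Determinant.det (Matrix.mat p p (\<lambda>(i, j). real (l i choose j)))"

lemma det_mat_expand:
  "Determinant.det (Matrix.mat p p (\<lambda>(i, j). f i j)) =
     (\<Sum>\<sigma> | \<sigma> permutes {0..<p}. signof \<sigma> * (\<Prod>i=0..<p. f i (\<sigma> i)))"
  by (subst det_def'[of _ p]) (auto intro!: sum.cong prod.cong dest: permutes_in_image)

lemma binomial_det_expand:
  "binomial_det p l = (\<Sum>\<sigma> | \<sigma> permutes {0..<p}. signof \<sigma> * (\<Prod>i=0..<p. real (l i choose \<sigma> i)))"
  unfolding binomial_det_def by (rule det_mat_expand)

lemma binomial_det_cong: "(\<And>i. i < p \<Longrightarrow> l i = l' i) \<Longrightarrow> binomial_det p l = binomial_det p l'"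
  unfolding binomial_det_def by (intro arg_cong[of _ _ Determinant.det] eq_matI) auto

lemma binomial_det_eq_0:
  assumes "i < p" "j < p" "i \<noteq> j" "l i = l j"
  shows "binomial_det p l = 0"
  unfolding binomial_det_def using assms
  by (intro det_identical_rows[of _ p i j]) (auto intro!: eq_vecI)

lemma real_binomial_absorb: "real l * real (l - 1 choose j) = (real l - real j) * real (l choose j)"
proof (cases "j \<le> l")
  case True
  then show ?thesis
    using arg_cong[OF binomial_absorb_comp[of l j], of real] by (simp add: of_nat_diff)
qed (simp add: binomial_eq_0)

text \<open>Since l C(l - 1, j) = (l - j) C(l, j), lowering \<open>l i\<close> multiplies the term
  of \<sigma> by \<open>l i - \<sigma> i\<close>. Summed over \<open>i\<close>, this factor is the
  same for every \<sigma>, because \<sigma> permutes the column indices. At \<open>l i = 0\<close>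
  the truncated subtraction is harmless, the weight being 0.\<close>

lemma binomial_det_down:
  "(\<Sum>i<p. real (l i) * binomial_det p (l(i := l i - 1))) = ((\<Sum>i<p. real (l i)) - (\<Sum>i<p. real i)) * binomial_det p l"
proof -
  have "real (l i) * (\<Prod>i'=0..<p. real ((l(i := l i - 1)) i' choose \<sigma> i')) =
        (real (l i) - real (\<sigma> i)) * (\<Prod>i'=0..<p. real (l i' choose \<sigma> i'))"
    if "i < p" for i \<sigma>
  proof -
    have "(\<Prod>i'=0..<p. real ((l(i := l i - 1)) i' choose \<sigma> i')) =
        real (l i - 1 choose \<sigma> i) * (\<Prod>i'\<in>{0..<p}-{i}. real (l i' choose \<sigma> i'))"
      using that by (subst prod.remove[of _ i]) (auto intro!: prod.cong)
    moreover have "(\<Prod>i'=0..<p. real (l i' choose \<sigma> i')) =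
        real (l i choose \<sigma> i) * (\<Prod>i'\<in>{0..<p}-{i}. real (l i' choose \<sigma> i'))"
      using that by (subst prod.remove[of _ i]) auto
    ultimately show ?thesis
      using real_binomial_absorb[of "l i" "\<sigma> i"] by (simp add: mult.assoc[symmetric])
  qed
  then have "(\<Sum>i<p. real (l i) * binomial_det p (l(i := l i - 1))) =
    (\<Sum>i<p. \<Sum>\<sigma> | \<sigma> permutes {0..<p}.
       signof \<sigma> * ((real (l i) - real (\<sigma> i)) * (\<Prod>i'=0..<p. real (l i' choose \<sigma> i'))))"
    unfolding binomial_det_expand sum_distrib_left
    by (intro sum.cong refl) (simp add: mult.left_commute)
  also have "\<dots> = (\<Sum>\<sigma> | \<sigma> permutes {0..<p}. \<Sum>i<p.
       signof \<sigma> * ((real (l i) - real (\<sigma> i)) * (\<Prod>i'=0..<p. real (l i' choose \<sigma> i'))))"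
    by (rule sum.swap)
  also have "\<dots> = (\<Sum>\<sigma> | \<sigma> permutes {0..<p}. ((\<Sum>i<p. real (l i)) - (\<Sum>i<p. real i)) *
       (signof \<sigma> * (\<Prod>i'=0..<p. real (l i' choose \<sigma> i'))))"
  proof (intro sum.cong refl)
    fix \<sigma> assume "\<sigma> \<in> {\<sigma>. \<sigma> permutes {0..<p}}"
    then have "(\<Sum>i<p. real (\<sigma> i)) = (\<Sum>i<p. real i)"
      using sum.permute[of \<sigma> "{0..<p}" real] by (simp add: atLeast0LessThan o_def)
    then show "(\<Sum>i<p. signof \<sigma> * ((real (l i) - real (\<sigma> i)) * (\<Prod>i'=0..<p. real (l i' choose \<sigma> i')))) =
        ((\<Sum>i<p. real (l i)) - (\<Sum>i<p. real i)) * (signof \<sigma> * (\<Prod>i'=0..<p. real (l i' choose \<sigma> i')))"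
      by (simp add: sum_distrib_left[symmetric] sum_distrib_right[symmetric] sum_subtractf
          mult.left_commute)
  qed
  finally show ?thesis unfolding binomial_det_expand sum_distrib_left .
qed

text \<open>Both sides are the derivative at t = 0 of the determinant with entries
  \<open>a i j + t * b i j\<close>, once taken row by row and once column by column: in each
  permutation term one of the \<open>n\<close> entries is replaced.\<close>

lemma sum_replace_row_eq_sum_replace_column:
  fixes a b :: "nat \<Rightarrow> nat \<Rightarrow> real"
  shows "(\<Sum>i<n. \<Sum>\<sigma> | \<sigma> permutes {0..<n}.
            signof \<sigma> * (b i (\<sigma> i) * (\<Prod>i'\<in>{0..<n} - {i}. a i' (\<sigma> i')))) =
         (\<Sum>j<n. Determinant.det (Matrix.mat n n (\<lambda>(i, j'). if j' = j then b i j' else a i j')))"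
proof -
  have "(\<Sum>i<n. b i (\<sigma> i) * (\<Prod>i'\<in>{0..<n} - {i}. a i' (\<sigma> i'))) =
        (\<Sum>j<n. \<Prod>i=0..<n. if \<sigma> i = j then b i (\<sigma> i) else a i (\<sigma> i))"
    if \<sigma>: "\<sigma> permutes {0..<n}" for \<sigma>
  proof -
    have "(\<Sum>j<n. \<Prod>i=0..<n. if \<sigma> i = j then b i (\<sigma> i) else a i (\<sigma> i)) =
          (\<Sum>k<n. \<Prod>i=0..<n. if \<sigma> i = \<sigma> k then b i (\<sigma> i) else a i (\<sigma> i))"
      using sum.permute[OF \<sigma>, of "\<lambda>j. \<Prod>i=0..<n. if \<sigma> i = j then b i (\<sigma> i) else a i (\<sigma> i)"]
      by (simp add: atLeast0LessThan o_def)
    also have "\<dots> = (\<Sum>k<n. b k (\<sigma> k) * (\<Prod>i'\<in>{0..<n} - {k}. a i' (\<sigma> i')))"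
    proof (intro sum.cong refl)
      fix k assume "k \<in> {..<n}"
      then show "(\<Prod>i=0..<n. if \<sigma> i = \<sigma> k then b i (\<sigma> i) else a i (\<sigma> i)) =
          b k (\<sigma> k) * (\<Prod>i'\<in>{0..<n} - {k}. a i' (\<sigma> i'))"
        by (subst prod.remove[of _ k])
          (auto intro!: prod.cong simp: inj_eq[OF permutes_inj[OF \<sigma>]])
    qed
    finally show ?thesis ..
  qed
  then have "(\<Sum>\<sigma> | \<sigma> permutes {0..<n}. \<Sum>i<n.
            signof \<sigma> * (b i (\<sigma> i) * (\<Prod>i'\<in>{0..<n} - {i}. a i' (\<sigma> i')))) =
      (\<Sum>\<sigma> | \<sigma> permutes {0..<n}. \<Sum>j<n.
            signof \<sigma> * (\<Prod>i=0..<n. if \<sigma> i = j then b i (\<sigma> i) else a i (\<sigma> i)))"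
    by - (rule sum.cong[OF refl], simp only: mem_Collect_eq sum_distrib_left[symmetric])
  then show ?thesis
    unfolding det_mat_expand by (subst (1 2) sum.swap)
qed

text \<open>The first summand yields the factor in \<open>binomial_det_up\<close>; the second is a
  multiple of the entry one column to the left and will drop out of the determinants. For
  \<open>j = 0\<close> the truncated \<open>j - 1\<close> is multiplied by 0.\<close>

lemma real_binomial_up:
  "real (l + 1) * real (l + 1 choose j) =
     real (l + 1 + j) * real (l choose j) + real j * real (l choose (j - 1))"
proof (cases j)
  case (Suc m)
  have "real l * real (l choose m) = real m * real (l choose m) + real (Suc m) * real (l choose Suc m)"
  proof (cases "m \<le> l")
    case True
    have "Suc m * (l choose Suc m) = (l - m) * (l choose m)"
      unfolding binomial_absorption binomial_absorb_comp ..
    from arg_cong[OF this, of real]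
    have "real (Suc m) * real (l choose Suc m) = (real l - real m) * real (l choose m)"
      using True by (simp only: of_nat_mult of_nat_diff)
    then show ?thesis by (simp add: algebra_simps)
  qed (simp add: binomial_eq_0)
  then show ?thesis by (simp add: Suc algebra_simps)
qed simp

lemma binomial_det_up:
  "(\<Sum>i<p. real (l i + 1) * binomial_det p (l(i := l i + 1))) =
     ((\<Sum>i<p. real (l i)) + (\<Sum>i<p. real i) + real p) * binomial_det p l"
proof -
  define a where "a i j = real (l i choose j)" for i j
  define b where "b i j = real j * real (l i choose (j - 1))" for i j
  have exp: "real (l i + 1) * (\<Prod>i'=0..<p. real ((l(i := l i + 1)) i' choose \<sigma> i')) =
        real (l i + 1 + \<sigma> i) * (\<Prod>i'=0..<p. a i' (\<sigma> i')) + b i (\<sigma> i) * (\<Prod>i'\<in>{0..<p}-{i}. a i' (\<sigma> i'))"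
    if "i < p" for i \<sigma>
  proof -
    have "(\<Prod>i'=0..<p. real ((l(i := l i + 1)) i' choose \<sigma> i')) =
        real (l i + 1 choose \<sigma> i) * (\<Prod>i'\<in>{0..<p}-{i}. a i' (\<sigma> i'))"
      using that by (subst prod.remove[of _ i]) (auto intro!: prod.cong simp: a_def)
    moreover have "(\<Prod>i'=0..<p. a i' (\<sigma> i')) =
        a i (\<sigma> i) * (\<Prod>i'\<in>{0..<p}-{i}. a i' (\<sigma> i'))"
      using that by (subst prod.remove[of _ i]) auto
    ultimately show ?thesis
      using real_binomial_up[of "l i" "\<sigma> i"]
      by (simp only: mult.assoc[symmetric] distrib_right[symmetric] a_def b_def)
  qed
  \<comment> \<open>Passing from rows to columns turns the correction terms into determinants whose
    column \<open>j\<close> is a multiple of column \<open>j - 1\<close>, or is 0 if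
    \<open>j = 0\<close>.\<close>
  have zero: "Determinant.det (Matrix.mat p p (\<lambda>(i, j'). if j' = j then b i j' else a i j')) = 0"
    if j: "j < p" for j
  proof (cases j)
    case 0
    have "Determinant.det (Matrix.mat p p (\<lambda>(i, j'). if j' = j then b i j' else a i j')) = 
      (\<Sum>\<sigma> | \<sigma> permutes {0..<p}. signof \<sigma> * (\<Prod>i=0..<p. if \<sigma> i = 0 then 0 else a i (\<sigma> i)))"
      unfolding det_mat_expand by (intro sum.cong prod.cong arg_cong2[of _ _ _ _ "(*)"] refl) (simp add: 0 b_def)
    also have "\<dots> = 0"
    proof (intro sum.neutral ballI)
      fix \<sigma> assume "\<sigma> \<in> {\<sigma>. \<sigma> permutes {0..<p}}"
      then have "0 \<in> \<sigma> ` {0..<p}" using j 0 permutes_image[of \<sigma> "{0..<p}"] by auto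
      then obtain i where "i < p" "\<sigma> i = 0" by auto
      then have "(\<Prod>i=0..<p. if \<sigma> i = 0 then 0 else a i (\<sigma> i)) = 0"
        by (intro prod_zero) (auto intro!: bexI[of _ i])
      then show "signof \<sigma> * (\<Prod>i=0..<p. if \<sigma> i = 0 then 0 else a i (\<sigma> i)) = 0" by simp
    qed
    finally show ?thesis .
  next
    case (Suc m)
    let ?B = "Matrix.mat p p (\<lambda>(i, j'). if j' = j then a i m else a i j')"
    have "Determinant.det (Matrix.mat p p (\<lambda>(i, j'). if j' = j then b i j' else a i j')) = 
      real j * Determinant.det ?B"
      unfolding det_mat_expand sum_distrib_left
    proof (intro sum.cong refl)
      fix \<sigma> assume "\<sigma> \<in> {\<sigma>. \<sigma> permutes {0..<p}}"
      then have \<sigma>: "\<sigma> permutes {0..<p}" by simp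
      then have "j \<in> \<sigma> ` {0..<p}" using j permutes_image[of \<sigma> "{0..<p}"] by auto
      then obtain i where i: "i < p" "\<sigma> i = j" by auto
      have "(\<Prod>i=0..<p. if \<sigma> i = j then b i (\<sigma> i) else a i (\<sigma> i)) =
            b i j * (\<Prod>i\<in>{0..<p}-{i}. a i (\<sigma> i))"
        using i(1) unfolding i(2)[symmetric]
        by (subst prod.remove[of _ i])
          (auto intro!: prod.cong simp: inj_eq[OF permutes_inj[OF \<sigma>]])
      moreover have "(\<Prod>i=0..<p. if \<sigma> i = j then a i m else a i (\<sigma> i)) =
            a i m * (\<Prod>i\<in>{0..<p}-{i}. a i (\<sigma> i))"
        using i(1) unfolding i(2)[symmetric]
        by (subst prod.remove[of _ i])
          (auto intro!: prod.cong simp: inj_eq[OF permutes_inj[OF \<sigma>]])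
      ultimately show "signof \<sigma> * (\<Prod>i=0..<p. if \<sigma> i = j then b i (\<sigma> i) else a i (\<sigma> i)) =
         real j * (signof \<sigma> * (\<Prod>i=0..<p. if \<sigma> i = j then a i m else a i (\<sigma> i)))"
        by (simp add: b_def a_def Suc)
    qed
    also have "Determinant.det ?B = 0"
      using j Suc by (intro det_identical_columns[of _ p j m]) (auto intro!: eq_vecI)
    finally show ?thesis by simp
  qed
  have "(\<Sum>i<p. real (l i + 1) * binomial_det p (l(i := l i + 1))) =
    (\<Sum>i<p. \<Sum>\<sigma> | \<sigma> permutes {0..<p}.
       real (l i + 1 + \<sigma> i) * (signof \<sigma> * (\<Prod>i'=0..<p. a i' (\<sigma> i')))) +
    (\<Sum>i<p. \<Sum>\<sigma> | \<sigma> permutes {0..<p}.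
       signof \<sigma> * (b i (\<sigma> i) * (\<Prod>i'\<in>{0..<p}-{i}. a i' (\<sigma> i'))))"
    unfolding binomial_det_expand sum_distrib_left sum.distrib[symmetric]
  proof (intro sum.cong refl)
    fix i \<sigma> assume "i \<in> {..<p}"
    then show "real (l i + 1) * (signof \<sigma> * (\<Prod>i'=0..<p. real ((l(i := l i + 1)) i' choose \<sigma> i'))) =
      real (l i + 1 + \<sigma> i) * (signof \<sigma> * (\<Prod>i'=0..<p. a i' (\<sigma> i'))) +
      signof \<sigma> * (b i (\<sigma> i) * (\<Prod>i'\<in>{0..<p}-{i}. a i' (\<sigma> i')))"
      using arg_cong[OF exp[of i \<sigma>], of "\<lambda>x. signof \<sigma> * x"]
      by (simp add: algebra_simps del: fun_upd_apply of_nat_add)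
  qed
  also have "(\<Sum>i<p. \<Sum>\<sigma> | \<sigma> permutes {0..<p}.
       signof \<sigma> * (b i (\<sigma> i) * (\<Prod>i'\<in>{0..<p}-{i}. a i' (\<sigma> i')))) = 0"
    unfolding sum_replace_row_eq_sum_replace_column using zero by simp
  also have "(\<Sum>i<p. \<Sum>\<sigma> | \<sigma> permutes {0..<p}.
       real (l i + 1 + \<sigma> i) * (signof \<sigma> * (\<Prod>i'=0..<p. a i' (\<sigma> i')))) =
     (\<Sum>\<sigma> | \<sigma> permutes {0..<p}. \<Sum>i<p.
       real (l i + 1 + \<sigma> i) * (signof \<sigma> * (\<Prod>i'=0..<p. a i' (\<sigma> i'))))"
    by (rule sum.swap)
  also have "\<dots> = (\<Sum>\<sigma> | \<sigma> permutes {0..<p}. ((\<Sum>i<p. real (l i)) + (\<Sum>i<p. real i) + real p) *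
       (signof \<sigma> * (\<Prod>i'=0..<p. a i' (\<sigma> i'))))"
  proof (intro sum.cong refl)
    fix \<sigma> assume "\<sigma> \<in> {\<sigma>. \<sigma> permutes {0..<p}}"
    then have "(\<Sum>i<p. real (\<sigma> i)) = (\<Sum>i<p. real i)"
      using sum.permute[of \<sigma> "{0..<p}" real] by (simp add: atLeast0LessThan o_def)
    then show "(\<Sum>i<p. real (l i + 1 + \<sigma> i) * (signof \<sigma> * (\<Prod>i'=0..<p. a i' (\<sigma> i')))) =
        ((\<Sum>i<p. real (l i)) + (\<Sum>i<p. real i) + real p) * (signof \<sigma> * (\<Prod>i'=0..<p. a i' (\<sigma> i')))"
      by (simp add: sum_distrib_right[symmetric] sum.distrib)
  qed
  finally show ?thesis unfolding binomial_det_expand sum_distrib_left a_def by simp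
qed

text \<open>Vandermonde's convolution writes C(l + N, j) as the sum over k of C(l, k) C(N, j - k),
  so the shift multiplies the matrix from the right by a unitriangular one.\<close>

lemma binomial_det_shift: "binomial_det p (\<lambda>i. l i + N) = binomial_det p l"
proof -
  let ?A = "Matrix.mat p p (\<lambda>(i, j). real (l i choose j))"
  let ?U = "Matrix.mat p p (\<lambda>(i, j). if i \<le> j then real (N choose (j - i)) else 0)"
  have "Matrix.mat p p (\<lambda>(i, j). real (l i + N choose j)) = ?A * ?U"
  proof (rule eq_matI)
    fix i j assume *: "i < dim_row (?A * ?U)" "j < dim_col (?A * ?U)"
    then have "(?A * ?U) $$ (i, j) =
        (\<Sum>k=0..<p. real (l i choose k) * (if k \<le> j then real (N choose (j - k)) else 0))"
      by (simp add: scalar_prod_def)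
    also have "\<dots> = (\<Sum>k\<le>j. real (l i choose k) * real (N choose (j - k)))"
      using * by (intro sum.mono_neutral_cong_right) auto
    also have "\<dots> = real (\<Sum>k\<le>j. (l i choose k) * (N choose (j - k)))" by simp
    also have "\<dots> = real (l i + N choose j)" unfolding vandermonde ..
    finally show "Matrix.mat p p (\<lambda>(i, j). real (l i + N choose j)) $$ (i, j) = (?A * ?U) $$ (i, j)"
      using * by simp
  qed auto
  moreover have "Determinant.det ?U = 1"
    by (subst det_upper_triangular[of _ p]) (auto simp: prod_list_diag_prod)
  ultimately show ?thesis
    unfolding binomial_det_def by (simp add: det_mult[of _ p])
qed

lemma det_sum_rows:
  fixes f :: "nat \<Rightarrow> nat \<Rightarrow> real"
  assumes "\<And>i. i < p \<Longrightarrow> finite (B i)"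
  shows "(\<Sum>m\<in>PiE {0..<p} B. Determinant.det (Matrix.mat p p (\<lambda>(i, j). f (m i) j))) =
    Determinant.det (Matrix.mat p p (\<lambda>(i, j). \<Sum>x\<in>B i. f x j))"
proof -
  have "(\<Sum>m\<in>PiE {0..<p} B. Determinant.det (Matrix.mat p p (\<lambda>(i, j). f (m i) j))) =
    (\<Sum>\<sigma> | \<sigma> permutes {0..<p}. \<Sum>m\<in>PiE {0..<p} B. signof \<sigma> * (\<Prod>i=0..<p. f (m i) (\<sigma> i)))"
    unfolding det_mat_expand by (rule sum.swap)
  also have "\<dots> = (\<Sum>\<sigma> | \<sigma> permutes {0..<p}. signof \<sigma> * (\<Prod>i=0..<p. \<Sum>x\<in>B i. f x (\<sigma> i)))"
    using assms by (subst prod_sum_PiE) (auto simp: sum_distrib_left)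
  finally show ?thesis unfolding det_mat_expand .
qed

lemma sum_choose_interval:
  assumes "a \<le> b"
  shows "(\<Sum>x\<in>{a..<b}. real (x choose j)) = real (b choose Suc j) - real (a choose Suc j)"
  using assms by (induction b rule: dec_induct) auto

text \<open>Subtracting each row from the next, which is multiplication by \<open>?L\<close>, turns
  the first column of ones into a unit vector. Expansion along it leaves differences of C(l, j + 1)
  at consecutive l. Each is a sum of C(x, j) over an interval, and multilinearity in the rows pulls
  these sums out.\<close>

lemma binomial_det_branching:
  assumes "\<And>i. i < p \<Longrightarrow> l i \<le> l (Suc i)"
  shows "(\<Sum>m\<in>PiE {0..<p} (\<lambda>i. {l i..<l (Suc i)}). binomial_det p m) = binomial_det (Suc p) l"
proof -
  let ?A = "Matrix.mat (Suc p) (Suc p) (\<lambda>(i, j). real (l i choose j))"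
  let ?L = "Matrix.mat (Suc p) (Suc p) (\<lambda>(i, j). if i = j then 1 else if i = Suc j then -1 else (0::real))"
  have entry: "(?L * ?A) $$ (i, j) = real (l i choose j) - (if i = 0 then 0 else real (l (i - 1) choose j))"
    if "i < Suc p" "j < Suc p" for i j
  proof -
    have "(?L * ?A) $$ (i, j) =
        (\<Sum>k=0..<Suc p. (if i = k then 1 else if i = Suc k then -1 else 0) * real (l k choose j))"
      using that by (simp add: scalar_prod_def del: sum.op_ivl_Suc)
    also have "\<dots> = (\<Sum>k=0..<Suc p. (if k = i then real (l k choose j) else 0)) -
         (\<Sum>k=0..<Suc p. (if i = Suc k then real (l k choose j) else 0))"
      unfolding sum_subtractf[symmetric] by (intro sum.cong) auto
    also have "(\<Sum>k=0..<Suc p. (if i = Suc k then real (l k choose j) else 0)) =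
       (if i = 0 then 0 else real (l (i - 1) choose j))"
    proof (cases i)
      case (Suc i')
      then have "(\<Sum>k=0..<Suc p. (if i = Suc k then real (l k choose j) else 0)) =
        (\<Sum>k=0..<Suc p. (if k = i' then real (l k choose j) else 0))"
        by (intro sum.cong) auto
      then show ?thesis using Suc that by (simp del: sum.op_ivl_Suc)
    qed simp
    finally show ?thesis using that by (simp del: sum.op_ivl_Suc)
  qed
  have "Determinant.det ?L = 1"
    by (subst det_lower_triangular[of "Suc p"]) (auto simp: prod_list_diag_prod simp del: prod.op_ivl_Suc)
  then have "binomial_det (Suc p) l = Determinant.det (?L * ?A)"
    unfolding binomial_det_def by (simp add: det_mult[of _ "Suc p"])
  also have "\<dots> = (\<Sum>i<Suc p. (?L * ?A) $$ (i, 0) * cofactor (?L * ?A) i 0)"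
    by (rule laplace_expansion_column) auto
  also have "\<dots> = (\<Sum>i<Suc p. if i = 0 then cofactor (?L * ?A) 0 0 else 0)"
    by (intro sum.cong refl) (auto simp: entry simp del: index_mult_mat)
  also have "\<dots> = Determinant.det (mat_delete (?L * ?A) 0 0)"
    by (simp add: cofactor_def del: sum.lessThan_Suc)
  also have "mat_delete (?L * ?A) 0 0 =
     Matrix.mat p p (\<lambda>(i, j). \<Sum>x\<in>{l i..<l (Suc i)}. real (x choose j))"
  proof (rule eq_matI)
    fix i j assume "i < dim_row (Matrix.mat p p (\<lambda>(i, j). \<Sum>x\<in>{l i..<l (Suc i)}. real (x choose j)))"
      "j < dim_col (Matrix.mat p p (\<lambda>(i, j). \<Sum>x\<in>{l i..<l (Suc i)}. real (x choose j)))"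
    then have ij: "i < p" "j < p" by auto
    then have "mat_delete (?L * ?A) 0 0 $$ (i, j) = (?L * ?A) $$ (Suc i, Suc j)"
      by (simp add: mat_delete_def)
    also have "\<dots> = real (l (Suc i) choose Suc j) - real (l i choose Suc j)"
      using ij by (subst entry) auto
    finally show "mat_delete (?L * ?A) 0 0 $$ (i, j) =
      Matrix.mat p p (\<lambda>(i, j). \<Sum>x\<in>{l i..<l (Suc i)}. real (x choose j)) $$ (i, j)"
      using ij assms by (simp add: sum_choose_interval)
  qed (auto simp: mat_delete_def)
  finally show ?thesis unfolding binomial_det_def by (subst det_sum_rows) auto
qed

section \<open>Principal specialisations of Schur functions\<close>

text \<open>Partitions are indexed from \<open>0\<close>: the first part is \<open>\<nu> 0\<close>.\<close>

definition partitions :: "nat \<Rightarrow> nat \<Rightarrow> (nat \<Rightarrow> nat) set" where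
  "partitions p n = {\<nu>. (\<forall>i. \<nu> (Suc i) \<le> \<nu> i) \<and> (\<forall>i\<ge>p. \<nu> i = 0) \<and> (\<Sum>i<p. \<nu> i) = n}"

text \<open>In other words, the boxes of \<nu> outside \<mu> form a horizontal strip, like the boxes
  of one letter in a semistandard tableau.\<close>

definition interlaces :: "(nat \<Rightarrow> nat) \<Rightarrow> (nat \<Rightarrow> nat) \<Rightarrow> bool" where
  "interlaces \<mu> \<nu> \<longleftrightarrow> (\<forall>i. \<nu> (Suc i) \<le> \<mu> i \<and> \<mu> i \<le> \<nu> i)"

text \<open>Level \<open>z\<close> is the shape filled by the letters up to \<open>z\<close>.
  Freezing all levels from \<open>p\<close> on at \<nu> makes the function unique for each tableau,
  so that its cardinality counts tableaux.\<close>

definition gt_patterns :: "nat \<Rightarrow> (nat \<Rightarrow> nat) \<Rightarrow> (nat \<Rightarrow> nat \<Rightarrow> nat) set" where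
  "gt_patterns p \<nu> =
     {g. g 0 = (\<lambda>_. 0) \<and> (\<forall>z<p. interlaces (g z) (g (Suc z))) \<and> (\<forall>z\<ge>p. g z = \<nu>)}"

text \<open>The number \<open>s\<^sub>\<nu>(1\<^sup>p)\<close> of semistandard tableaux, with the shifted parts \<open>\<nu> (p - 1 - i) + i\<close> in
  increasing order.\<close>

definition schur1 :: "nat \<Rightarrow> (nat \<Rightarrow> nat) \<Rightarrow> real" where
  "schur1 p \<nu> = binomial_det p (\<lambda>i. \<nu> (p - 1 - i) + i)"

text \<open>In the increasing shifted coordinates \<open>F \<mu>\<close> the interlacing
  inequalities decouple: each coordinate has its own interval \<open>{l i..<l (Suc i)}\<close>,
  half-open because of the shift by \<open>i\<close>. The condition \<open>\<mu> p = 0\<close>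
  restricts \<mu> to the \<open>p\<close> rows that \<open>p\<close> letters can fill.\<close>

lemma schur1_branching:
  assumes dec: "\<And>i. \<nu> (Suc i) \<le> \<nu> i" and supp: "\<And>i. i \<ge> Suc p \<Longrightarrow> \<nu> i = 0"
  shows "(\<Sum>\<mu> | interlaces \<mu> \<nu> \<and> \<mu> p = 0. schur1 p \<mu>) = schur1 (Suc p) \<nu>"
    and "finite {\<mu>. interlaces \<mu> \<nu> \<and> \<mu> p = 0}"
proof -
  define l where "l i = \<nu> (p - i) + i" for i
  define F where "F \<mu> = (\<lambda>i\<in>{0..<p}. \<mu> (p - 1 - i) + i)" for \<mu> :: "nat \<Rightarrow> nat"
  define G where "G m i = (if i < p then m (p - 1 - i) - (p - 1 - i) else 0)" for m :: "nat \<Rightarrow> nat" and i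
  have l_Suc: "l (Suc i) = \<nu> (p - 1 - i) + Suc i" if "i < p" for i
    using that by (simp add: l_def)
  have l_alt: "l i = \<nu> (Suc (p - 1 - i)) + i" if "i < p" for i
  proof -
    have "p - i = Suc (p - 1 - i)" using that by simp
    then show ?thesis by (simp only: l_def)
  qed
  have bij: "bij_betw F {\<mu>. interlaces \<mu> \<nu> \<and> \<mu> p = 0} (PiE {0..<p} (\<lambda>i. {l i..<l (Suc i)}))"
  proof (rule bij_betw_byWitness[where f' = G])
    show "\<forall>\<mu>\<in>{\<mu>. interlaces \<mu> \<nu> \<and> \<mu> p = 0}. G (F \<mu>) = \<mu>"
    proof (intro ballI ext)
      fix \<mu> i assume "\<mu> \<in> {\<mu>. interlaces \<mu> \<nu> \<and> \<mu> p = 0}"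
      then have *: "interlaces \<mu> \<nu>" "\<mu> p = 0" by auto
      have "\<mu> i = 0" if "i \<ge> p"
      proof (cases "i = p")
        case False
        then have "\<nu> i = 0" using that by (intro supp) simp
        then show ?thesis using * by (metis interlaces_def le_zero_eq)
      qed (use * in simp)
      then show "G (F \<mu>) i = \<mu> i"
        by (auto simp: G_def F_def)
    qed
    show "\<forall>m\<in>PiE {0..<p} (\<lambda>i. {l i..<l (Suc i)}). F (G m) = m"
    proof (intro ballI ext)
      fix m i assume m: "m \<in> PiE {0..<p} (\<lambda>i. {l i..<l (Suc i)})"
      show "F (G m) i = m i"
      proof (cases "i < p")
        case True
        then have "m i \<ge> i" using PiE_mem[OF m, of i] by (auto simp: l_def)
        then show ?thesis using True by (simp add: F_def G_def)
      next
        case False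
        then show ?thesis using m by (auto simp: F_def PiE_def extensional_def)
      qed
    qed
    show "F ` {\<mu>. interlaces \<mu> \<nu> \<and> \<mu> p = 0} \<subseteq> PiE {0..<p} (\<lambda>i. {l i..<l (Suc i)})"
    proof (clarify)
      fix \<mu> assume *: "interlaces \<mu> \<nu>" "\<mu> p = 0"
      show "F \<mu> \<in> PiE {0..<p} (\<lambda>i. {l i..<l (Suc i)})"
        unfolding F_def
      proof (rule restrict_PiE_iff[THEN iffD2], rule ballI)
        fix i assume i: "i \<in> {0..<p}"
        have "\<nu> (Suc (p - 1 - i)) \<le> \<mu> (p - 1 - i)" "\<mu> (p - 1 - i) \<le> \<nu> (p - 1 - i)"
          using * by (auto simp: interlaces_def)
        then show "\<mu> (p - 1 - i) + i \<in> {l i..<l (Suc i)}"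
          using i l_alt[of i] l_Suc[of i] by simp
      qed
    qed
    show "G ` PiE {0..<p} (\<lambda>i. {l i..<l (Suc i)}) \<subseteq> {\<mu>. interlaces \<mu> \<nu> \<and> \<mu> p = 0}"
    proof (clarify)
      fix m assume m: "m \<in> PiE {0..<p} (\<lambda>i. {l i..<l (Suc i)})"
      have "\<nu> (Suc i) \<le> G m i \<and> G m i \<le> \<nu> i" for i
      proof (cases "i < p")
        case True
        then have *: "m (p - 1 - i) \<in> {l (p - 1 - i)..<l (Suc (p - 1 - i))}"
          by (intro PiE_mem[OF m]) auto
        obtain q where "p = Suc (i + q)" using True less_imp_Suc_add by blast
        with * show ?thesis
          by (auto simp: G_def l_def)
      next
        case False
        then show ?thesis using supp[of "Suc i"] by (simp add: G_def)
      qed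
      then show "interlaces (G m) \<nu> \<and> G m p = 0" by (simp add: interlaces_def G_def)
    qed
  qed
  then show "finite {\<mu>. interlaces \<mu> \<nu> \<and> \<mu> p = 0}"
    by (simp add: bij_betw_finite finite_PiE)
  have "(\<Sum>\<mu> | interlaces \<mu> \<nu> \<and> \<mu> p = 0. schur1 p \<mu>) =
        (\<Sum>\<mu> | interlaces \<mu> \<nu> \<and> \<mu> p = 0. binomial_det p (F \<mu>))"
    unfolding schur1_def by (intro sum.cong refl binomial_det_cong) (simp add: F_def)
  also have "\<dots> = (\<Sum>m\<in>PiE {0..<p} (\<lambda>i. {l i..<l (Suc i)}). binomial_det p m)"
    by (rule sum.reindex_bij_betw[OF bij])
  also have "\<dots> = binomial_det (Suc p) l"
  proof (rule binomial_det_branching)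
    fix i assume "i < p"
    then show "l i \<le> l (Suc i)"
      using dec[of "p - 1 - i"] by (simp add: l_alt l_Suc)
  qed
  also have "\<dots> = schur1 (Suc p) \<nu>" by (simp add: schur1_def l_def[abs_def])
  finally show "(\<Sum>\<mu> | interlaces \<mu> \<nu> \<and> \<mu> p = 0. schur1 p \<mu>) = schur1 (Suc p) \<nu>" .
qed

text \<open>Level 0 is empty, and each interlacing step opens at most one new row.\<close>

lemma gt_patterns_support:
  assumes "g \<in> gt_patterns p \<nu>"
  shows "z \<le> p \<Longrightarrow> i \<ge> z \<Longrightarrow> g z i = 0"
proof (induction z arbitrary: i)
  case 0
  then show ?case using assms by (simp add: gt_patterns_def)
next
  case (Suc z)
  then obtain i' where i': "i = Suc i'" "i' \<ge> z" by (cases i) auto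
  then have "g (Suc z) (Suc i') \<le> g z i'"
    using Suc.prems assms by (auto simp: gt_patterns_def interlaces_def)
  then show ?case using Suc i' by simp
qed

lemma gt_patterns_Suc:
  "bij_betw (\<lambda>(\<mu>, g) z. if z \<le> p then g z else \<nu>)
     (Sigma {\<mu>. interlaces \<mu> \<nu> \<and> \<mu> p = 0} (gt_patterns p)) (gt_patterns (Suc p) \<nu>)"
proof (rule bij_betw_byWitness[where f' = "\<lambda>g. (g p, \<lambda>z. if z \<le> p then g z else g p)"])
  show "(\<lambda>(\<mu>, g) z. if z \<le> p then g z else \<nu>) `
      Sigma {\<mu>. interlaces \<mu> \<nu> \<and> \<mu> p = 0} (gt_patterns p) \<subseteq> gt_patterns (Suc p) \<nu>"
    by (auto simp: gt_patterns_def less_Suc_eq)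
  show "(\<lambda>g. (g p, \<lambda>z. if z \<le> p then g z else g p)) ` gt_patterns (Suc p) \<nu> \<subseteq>
      Sigma {\<mu>. interlaces \<mu> \<nu> \<and> \<mu> p = 0} (gt_patterns p)"
  proof (rule image_subsetI)
    fix g assume g: "g \<in> gt_patterns (Suc p) \<nu>"
    then have "interlaces (g p) (g (Suc p))" "g (Suc p) = \<nu>" by (auto simp: gt_patterns_def)
    then show "(g p, \<lambda>z. if z \<le> p then g z else g p) \<in>
        Sigma {\<mu>. interlaces \<mu> \<nu> \<and> \<mu> p = 0} (gt_patterns p)"
      using gt_patterns_support[OF g, of p p] g by (auto simp: gt_patterns_def)
  qed
qed (auto simp: gt_patterns_def fun_eq_iff)

text \<open>Forgetting the top level gives the numbers of patterns the same branching rule as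
  \<open>schur1_branching\<close>, and both start at 1 for \<open>p = 0\<close>.\<close>

lemma card_gt_patterns:
  assumes "\<And>i. \<nu> (Suc i) \<le> \<nu> i" "\<And>i. i \<ge> p \<Longrightarrow> \<nu> i = 0"
  shows "finite (gt_patterns p \<nu>) \<and> real (card (gt_patterns p \<nu>)) = schur1 p \<nu>"
  using assms
proof (induction p arbitrary: \<nu>)
  case 0
  then have "\<nu> = (\<lambda>_. 0)" by auto
  then have "gt_patterns 0 \<nu> = {\<lambda>_. \<nu>}" by (auto simp: gt_patterns_def)
  then show ?case by (simp add: schur1_def binomial_det_def)
next
  case (Suc p)
  let ?I = "{\<mu>. interlaces \<mu> \<nu> \<and> \<mu> p = 0}"
  have IH: "finite (gt_patterns p \<mu>)" "real (card (gt_patterns p \<mu>)) = schur1 p \<mu>"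
    if "\<mu> \<in> ?I" for \<mu>
  proof -
    have "\<mu> (Suc i) \<le> \<nu> (Suc i)" "\<nu> (Suc i) \<le> \<mu> i" for i
      using that by (auto simp: interlaces_def)
    then have *: "\<mu> (Suc i) \<le> \<mu> i" for i
      by (rule order.trans)
    have "\<mu> i = 0" if "i \<ge> p" for i
      using lift_Suc_antimono_le[of \<mu>, OF * that] \<open>\<mu> \<in> ?I\<close> by simp
    from Suc.IH[of \<mu>, OF * this]
    show "finite (gt_patterns p \<mu>)" "real (card (gt_patterns p \<mu>)) = schur1 p \<mu>"
      by simp_all
  qed
  note br = schur1_branching[of \<nu> p, OF Suc.prems]
  have "finite (Sigma ?I (gt_patterns p))"
    by (intro finite_SigmaI br IH)
  then have fin: "finite (gt_patterns (Suc p) \<nu>)"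
    using bij_betw_finite[OF gt_patterns_Suc[of p \<nu>]] by blast
  have "card (Sigma ?I (gt_patterns p)) = (\<Sum>\<mu>\<in>?I. card (gt_patterns p \<mu>))"
    by (intro card_SigmaI br ballI IH)
  then have "real (card (gt_patterns (Suc p) \<nu>)) = (\<Sum>\<mu>\<in>?I. real (card (gt_patterns p \<mu>)))"
    unfolding bij_betw_same_card[OF gt_patterns_Suc[of p \<nu>]] by simp
  also have "\<dots> = schur1 (Suc p) \<nu>"
    by (rule trans[OF sum.cong[OF refl IH(2)] br(1)])
  finally show ?case using fin by blast
qed

section \<open>Weighted sums over the removal and the addition of a box\<close>

lemma schur1_down:
  assumes "\<nu> \<in> partitions p n"
  shows "(\<Sum>j | j < p \<and> \<nu> (Suc j) < \<nu> j. real (\<nu> j + (p - 1 - j)) * schur1 p (\<nu>(j := \<nu> j - 1))) =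
     real n * schur1 p \<nu>"
proof -
  define l where "l i = \<nu> (p - 1 - i) + i" for i
  have "(\<Sum>j | j < p \<and> \<nu> (Suc j) < \<nu> j. real (\<nu> j + (p - 1 - j)) * schur1 p (\<nu>(j := \<nu> j - 1))) =
    (\<Sum>j<p. real (l (p - 1 - j)) * binomial_det p (l(p - 1 - j := l (p - 1 - j) - 1)))"
  proof (intro sum.mono_neutral_cong_left ballI)
    \<comment> \<open>If row \<open>j\<close> has no corner, its lowered shifted part collides with
      that of row \<open>j + 1\<close> and two rows of the matrix coincide. In the last row the
      shifted part, hence the weight, is 0.\<close>
    fix j assume j: "j \<in> {..<p} - {j. j < p \<and> \<nu> (Suc j) < \<nu> j}"
    then have eq: "\<nu> (Suc j) = \<nu> j" using assms by (auto simp: partitions_def intro: le_antisym)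
    show "real (l (p - 1 - j)) * binomial_det p (l(p - 1 - j := l (p - 1 - j) - 1)) = 0"
    proof (cases "Suc j = p")
      case True
      then show ?thesis using eq assms by (auto simp: partitions_def l_def)
    next
      case False
      then have "p - 1 - j = Suc (p - 2 - j)" "p - 1 - (p - 2 - j) = Suc j" "p - 1 - (p - 1 - j) = j"
        using j by auto
      then have "l (p - 1 - j) - 1 = l (p - 2 - j)" "p - 1 - j \<noteq> p - 2 - j"
        using eq by (simp_all add: l_def)
      then have "binomial_det p (l(p - 1 - j := l (p - 1 - j) - 1)) = 0"
        using j by (intro binomial_det_eq_0[of "p - 1 - j" p "p - 2 - j"]) auto
      then show ?thesis by simp
    qed
  next
    fix j assume j: "j \<in> {j. j < p \<and> \<nu> (Suc j) < \<nu> j}"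
    then have [simp]: "p - Suc (p - Suc j) = j" by simp
    have "schur1 p (\<nu>(j := \<nu> j - 1)) = binomial_det p (l(p - 1 - j := l (p - 1 - j) - 1))"
      unfolding schur1_def
      using j by (intro binomial_det_cong) (auto simp: l_def)
    then show "real (\<nu> j + (p - 1 - j)) * schur1 p (\<nu>(j := \<nu> j - 1)) =
      real (l (p - 1 - j)) * binomial_det p (l(p - 1 - j := l (p - 1 - j) - 1))"
      by (simp add: l_def)
  qed auto
  also have "\<dots> = (\<Sum>i<p. real (l i) * binomial_det p (l(i := l i - 1)))"
    using sum.nat_diff_reindex[of "\<lambda>i. real (l i) * binomial_det p (l(i := l i - 1))" p] by simp
  also have "\<dots> = ((\<Sum>i<p. real (l i)) - (\<Sum>i<p. real i)) * binomial_det p l" by (rule binomial_det_down)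
  also have "(\<Sum>i<p. real (l i)) - (\<Sum>i<p. real i) = (\<Sum>i<p. real (\<nu> (p - Suc i)))"
    by (simp add: l_def sum.distrib)
  also have "\<dots> = real n"
    using assms sum.nat_diff_reindex[of "\<lambda>i. real (\<nu> i)" p] by (auto simp: partitions_def simp flip: of_nat_sum)
  also have "binomial_det p l = schur1 p \<nu>" by (simp add: schur1_def l_def[abs_def])
  finally show ?thesis .
qed

lemma sum_real_lessThan: "2 * (\<Sum>i<p. real i) + real p = (real p)\<^sup>2"
  by (induction p) (auto simp: power2_eq_square algebra_simps)

lemma schur1_up:
  assumes "\<nu> \<in> partitions p n"
  shows "(\<Sum>j | j < p \<and> (j = 0 \<or> \<nu> j < \<nu> (j - 1)). real (\<nu> j + 1 + (p - 1 - j)) * schur1 p (\<nu>(j := \<nu> j + 1))) =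
     (real n + (real p)\<^sup>2) * schur1 p \<nu>"
proof -
  define l where "l i = \<nu> (p - 1 - i) + i" for i
  have "(\<Sum>j | j < p \<and> (j = 0 \<or> \<nu> j < \<nu> (j - 1)). real (\<nu> j + 1 + (p - 1 - j)) * schur1 p (\<nu>(j := \<nu> j + 1))) =
    (\<Sum>j<p. real (l (p - 1 - j) + 1) * binomial_det p (l(p - 1 - j := l (p - 1 - j) + 1)))"
  proof (intro sum.mono_neutral_cong_left ballI)
    fix j assume j: "j \<in> {..<p} - {j. j < p \<and> (j = 0 \<or> \<nu> j < \<nu> (j - 1))}"
    then obtain k where k: "j = Suc k" by (cases j) auto
    then have eq: "\<nu> (Suc k) = \<nu> k" using assms j by (auto simp: partitions_def intro: le_antisym)
    have "l (p - 1 - j) + 1 = l (p - 1 - k)"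
      using eq j by (simp add: l_def k)
    then have "binomial_det p (l(p - 1 - j := l (p - 1 - j) + 1)) = 0"
      using j by (intro binomial_det_eq_0[of "p - 1 - j" p "p - 1 - k"]) (auto simp: k)
    then show "real (l (p - 1 - j) + 1) * binomial_det p (l(p - 1 - j := l (p - 1 - j) + 1)) = 0"
      by simp
  next
    fix j assume j: "j \<in> {j. j < p \<and> (j = 0 \<or> \<nu> j < \<nu> (j - 1))}"
    then have [simp]: "p - Suc (p - Suc j) = j" by simp
    have "schur1 p (\<nu>(j := \<nu> j + 1)) = binomial_det p (l(p - 1 - j := l (p - 1 - j) + 1))"
      unfolding schur1_def
      using j by (intro binomial_det_cong) (auto simp: l_def)
    then show "real (\<nu> j + 1 + (p - 1 - j)) * schur1 p (\<nu>(j := \<nu> j + 1)) =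
      real (l (p - 1 - j) + 1) * binomial_det p (l(p - 1 - j := l (p - 1 - j) + 1))"
      by (simp add: l_def)
  qed auto
  also have "\<dots> = (\<Sum>i<p. real (l i + 1) * binomial_det p (l(i := l i + 1)))"
    using sum.nat_diff_reindex[of "\<lambda>i. real (l i + 1) * binomial_det p (l(i := l i + 1))" p] by simp
  also have "\<dots> = ((\<Sum>i<p. real (l i)) + (\<Sum>i<p. real i) + real p) * binomial_det p l" by (rule binomial_det_up)
  \<comment> \<open>The staircase occurs once in the shifted parts and once in
    \<open>binomial_det_up\<close>; together with \<open>p\<close> this gives p^2.\<close>
  also have "(\<Sum>i<p. real (l i)) + (\<Sum>i<p. real i) + real p = (\<Sum>i<p. real (\<nu> (p - Suc i))) + (real p)\<^sup>2"
    by (simp add: l_def sum.distrib flip: sum_real_lessThan)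
  also have "(\<Sum>i<p. real (\<nu> (p - Suc i))) = real n"
    using assms sum.nat_diff_reindex[of "\<lambda>i. real (\<nu> i)" p] by (auto simp: partitions_def simp flip: of_nat_sum)
  also have "binomial_det p l = schur1 p \<nu>" by (simp add: schur1_def l_def[abs_def])
  finally show ?thesis .
qed

section \<open>Corners of a shape, standard tableaux and the sum of squares\<close>

definition removable :: "nat \<Rightarrow> (nat \<Rightarrow> nat) \<Rightarrow> nat set" where
  "removable p \<nu> = {j. j < p \<and> \<nu> (Suc j) < \<nu> j}"

definition addable :: "nat \<Rightarrow> (nat \<Rightarrow> nat) \<Rightarrow> nat set" where
  "addable p \<nu> = {j. j < p \<and> (j = 0 \<or> \<nu> j < \<nu> (j - 1))}"

lemma finite_removable [simp]: "finite (removable p \<nu>)"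
  by (simp add: removable_def)

lemma finite_addable [simp]: "finite (addable p \<nu>)"
  by (simp add: addable_def)

lemma removable_pos: "j \<in> removable p \<nu> \<Longrightarrow> 0 < \<nu> j"
  by (simp add: removable_def)

lemma finite_partitions: "finite (partitions p n)"
proof (rule finite_subset)
  show "partitions p n \<subseteq> {f. (\<forall>i. (i \<in> {..<p} \<longrightarrow> f i \<in> {..n}) \<and> (i \<notin> {..<p} \<longrightarrow> f i = 0))}"
    by (auto simp: partitions_def intro!: member_le_sum)
  show "finite {f. (\<forall>i. (i \<in> {..<p} \<longrightarrow> f i \<in> {..n}) \<and> (i \<notin> {..<p} \<longrightarrow> f i = (0::nat)))}"
    by (intro finite_set_of_finite_funs) auto
qed

lemma sum_fun_upd:
  fixes f :: "nat \<Rightarrow> nat"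
  assumes "j < p"
  shows "(\<Sum>i<p. (f(j := x)) i) + f j = (\<Sum>i<p. f i) + x"
proof -
  have "(\<Sum>i<p. (f(j := x)) i) = x + (\<Sum>i\<in>{..<p} - {j}. f i)"
    using assms by (subst sum.remove[of _ j]) auto
  moreover have "(\<Sum>i<p. f i) = f j + (\<Sum>i\<in>{..<p} - {j}. f i)"
    using assms by (subst sum.remove[of _ j]) auto
  ultimately show ?thesis by simp
qed

lemma remove_box:
  assumes "\<nu> \<in> partitions p (Suc n)" "j \<in> removable p \<nu>"
  shows "\<nu>(j := \<nu> j - 1) \<in> partitions p n" "j \<in> addable p (\<nu>(j := \<nu> j - 1))"
proof -
  have "(\<Sum>i<p. (\<nu>(j := \<nu> j - 1)) i) = n"
    using sum_fun_upd[of j p \<nu> "\<nu> j - 1"] assms by (auto simp: partitions_def removable_def)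
  moreover have "(\<nu>(j := \<nu> j - 1)) (Suc i) \<le> (\<nu>(j := \<nu> j - 1)) i" for i
    using assms by (cases "i = j"; cases "Suc i = j") (auto simp: partitions_def removable_def intro: order.trans[OF diff_le_self])
  ultimately show "\<nu>(j := \<nu> j - 1) \<in> partitions p n"
    using assms by (auto simp: partitions_def removable_def)
  show "j \<in> addable p (\<nu>(j := \<nu> j - 1))"
  proof (cases j)
    case 0
    then show ?thesis using assms by (simp add: addable_def removable_def)
  next
    case (Suc i)
    then have "\<nu> j \<le> \<nu> i" using assms by (simp add: partitions_def)
    then show ?thesis using assms Suc by (auto simp: addable_def removable_def)
  qed
qed

lemma add_box:
  assumes "\<nu> \<in> partitions p n" "j \<in> addable p \<nu>"
  shows "\<nu>(j := \<nu> j + 1) \<in> partitions p (Suc n)" "j \<in> removable p (\<nu>(j := \<nu> j + 1))"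
proof -
  have "(\<Sum>i<p. (\<nu>(j := \<nu> j + 1)) i) = Suc n"
    using sum_fun_upd[of j p \<nu> "\<nu> j + 1"] assms by (auto simp: partitions_def addable_def)
  moreover have "(\<nu>(j := \<nu> j + 1)) (Suc i) \<le> (\<nu>(j := \<nu> j + 1)) i" for i
    using assms by (cases "i = j"; cases "Suc i = j") (auto simp: partitions_def addable_def intro: le_SucI)
  ultimately show "\<nu>(j := \<nu> j + 1) \<in> partitions p (Suc n)"
    using assms by (auto simp: partitions_def addable_def)
  show "j \<in> removable p (\<nu>(j := \<nu> j + 1))"
    using assms by (auto simp: partitions_def addable_def removable_def less_Suc_eq_le)
qed

text \<open>The number of standard tableaux of shape \<nu>, by removing the box with the largest
  entry. The argument \<open>n\<close> is meant to be the number of boxes, so the base case is the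
  empty shape.\<close>

primrec syt_count :: "nat \<Rightarrow> nat \<Rightarrow> (nat \<Rightarrow> nat) \<Rightarrow> nat" where
  "syt_count p 0 \<nu> = 1"
| "syt_count p (Suc n) \<nu> = (\<Sum>j\<in>removable p \<nu>. syt_count p n (\<nu>(j := \<nu> j - 1)))"

lemma partitions_0: "partitions p 0 = {\<lambda>_. 0}"
proof -
  have "\<nu> i = 0" if "\<nu> \<in> partitions p 0" for \<nu> i
    using that by (cases "i < p") (auto simp: partitions_def)
  then have "partitions p 0 \<subseteq> {\<lambda>_. 0}" by blast
  then show ?thesis by (auto simp: partitions_def)
qed

lemma schur1_zero: "schur1 p (\<lambda>_. 0) = 1"
proof -
  have "schur1 p (\<lambda>_. 0) = prod_list (diag_mat (Matrix.mat p p (\<lambda>(i, j). real (i choose j))))"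
    unfolding schur1_def binomial_det_def by (subst det_lower_triangular[of p]) auto
  then show ?thesis by (simp add: prod_list_diag_prod)
qed

lemma schur1_shift: "schur1 p (\<lambda>i. if i < p then \<nu> i + N else 0) = schur1 p \<nu>"
proof -
  have "schur1 p (\<lambda>i. if i < p then \<nu> i + N else 0) = binomial_det p (\<lambda>i. \<nu> (p - 1 - i) + i + N)"
    unfolding schur1_def by (rule binomial_det_cong) simp
  then show ?thesis by (simp only: binomial_det_shift schur1_def)
qed

text \<open>This is Frobenius' form of the hook length formula. Removing a box in row
  \<open>j\<close> divides the product of factorials by \<open>\<nu> j + (p - 1 - j)\<close>, the
  weight in \<open>schur1_down\<close>, so that rule becomes the recursion of
  \<open>syt_count\<close>.\<close>

lemma syt_count_formula:
  assumes "\<nu> \<in> partitions p n"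
  shows "real (syt_count p n \<nu>) =
    fact n * (\<Prod>j<p. fact j) * schur1 p \<nu> / (\<Prod>i<p. fact (\<nu> i + (p - 1 - i)))"
  using assms
proof (induction n arbitrary: \<nu>)
  case 0
  have "(\<Prod>i<p. fact (p - 1 - i)) = (\<Prod>j<p. fact j :: real)"
    using prod.nat_diff_reindex[of fact p] by simp
  moreover have "(\<Prod>j<p. fact j :: real) \<noteq> 0" by simp
  ultimately show ?case using 0 by (simp add: partitions_0 schur1_zero)
next
  case (Suc n)
  define P where "P \<nu> = (\<Prod>i<p. fact (\<nu> i + (p - 1 - i)) :: real)" for \<nu>
  have P: "P \<nu> = real (\<nu> j + (p - 1 - j)) * P (\<nu>(j := \<nu> j - 1))" if "j \<in> removable p \<nu>" for j
  proof -
    have j: "j < p" "\<nu> j > 0" using that by (auto simp: removable_def)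
    have "P \<nu> = fact (\<nu> j + (p - 1 - j)) * (\<Prod>i\<in>{..<p}-{j}. fact (\<nu> i + (p - 1 - i)))"
      unfolding P_def using j by (subst prod.remove[of _ j]) auto
    also have "fact (\<nu> j + (p - 1 - j)) = real (\<nu> j + (p - 1 - j)) * fact (\<nu> j - 1 + (p - 1 - j))"
      using j by (subst fact_reduce) auto
    also have "(\<Prod>i\<in>{..<p}-{j}. fact (\<nu> i + (p - 1 - i)) :: real) =
      (\<Prod>i\<in>{..<p}-{j}. fact ((\<nu>(j := \<nu> j - 1)) i + (p - 1 - i)))"
      by (intro prod.cong) auto
    also have "real (\<nu> j + (p - 1 - j)) * fact (\<nu> j - 1 + (p - 1 - j)) * \<dots> =
       real (\<nu> j + (p - 1 - j)) * P (\<nu>(j := \<nu> j - 1))"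
      unfolding P_def using j by (subst (2) prod.remove[of _ j]) auto
    finally show ?thesis .
  qed
  have P0: "P \<nu> \<noteq> 0" for \<nu> by (simp add: P_def)
  have "real (syt_count p (Suc n) \<nu>) =
      (\<Sum>j\<in>removable p \<nu>. fact n * (\<Prod>j<p. fact j) * schur1 p (\<nu>(j := \<nu> j - 1)) / P (\<nu>(j := \<nu> j - 1)))"
    unfolding P_def syt_count.simps of_nat_sum
    by (intro sum.cong refl Suc.IH remove_box Suc.prems)
  also have "\<dots> = (\<Sum>j\<in>removable p \<nu>. fact n * (\<Prod>j<p. fact j) / P \<nu> *
       (real (\<nu> j + (p - 1 - j)) * schur1 p (\<nu>(j := \<nu> j - 1))))"
  proof (intro sum.cong refl)
    fix j assume j: "j \<in> removable p \<nu>"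
    have "real (\<nu> j + (p - 1 - j)) \<noteq> 0" using P[OF j] P0[of \<nu>] by auto
    moreover have "a * x / y = a / (c * y) * (c * x)" if "c \<noteq> 0" for a x y c :: real
      using that by simp
    ultimately show "fact n * (\<Prod>j<p. fact j) * schur1 p (\<nu>(j := \<nu> j - 1)) / P (\<nu>(j := \<nu> j - 1)) =
      fact n * (\<Prod>j<p. fact j) / P \<nu> * (real (\<nu> j + (p - 1 - j)) * schur1 p (\<nu>(j := \<nu> j - 1)))"
      unfolding P[OF j] by blast
  qed
  also have "\<dots> = fact n * (\<Prod>j<p. fact j) / P \<nu> * (real (Suc n) * schur1 p \<nu>)"
    unfolding sum_distrib_left[symmetric] using schur1_down[OF Suc.prems]
    by (simp only: removable_def)
  also have "\<dots> = fact (Suc n) * (\<Prod>j<p. fact j) * schur1 p \<nu> / P \<nu>" by simp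
  finally show ?case unfolding P_def .
qed

text \<open>Adding and removing a box are adjoint, so the two derivation rules for \<open>schur1\<close>
  combine to a recursion in the number of boxes.\<close>

lemma sum_schur1_sq_Suc:
  "real (Suc n) * (\<Sum>\<nu>\<in>partitions p (Suc n). (schur1 p \<nu>)\<^sup>2) =
   (real n + (real p)\<^sup>2) * (\<Sum>\<nu>\<in>partitions p n. (schur1 p \<nu>)\<^sup>2)"
proof -
  have "(real n + (real p)\<^sup>2) * (\<Sum>\<nu>\<in>partitions p n. (schur1 p \<nu>)\<^sup>2) =
    (\<Sum>\<nu>\<in>partitions p n. \<Sum>j\<in>addable p \<nu>.
       real (\<nu> j + 1 + (p - 1 - j)) * schur1 p (\<nu>(j := \<nu> j + 1)) * schur1 p \<nu>)"
    unfolding sum_distrib_left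
  proof (intro sum.cong refl)
    fix \<nu> assume "\<nu> \<in> partitions p n"
    from schur1_up[OF this]
    show "(real n + (real p)\<^sup>2) * (schur1 p \<nu>)\<^sup>2 =
      (\<Sum>j\<in>addable p \<nu>. real (\<nu> j + 1 + (p - 1 - j)) * schur1 p (\<nu>(j := \<nu> j + 1)) * schur1 p \<nu>)"
      unfolding sum_distrib_right[symmetric] addable_def[symmetric] by (simp add: power2_eq_square)
  qed
  also have "\<dots> = (\<Sum>(\<nu>, j)\<in>Sigma (partitions p n) (addable p).
       real (\<nu> j + 1 + (p - 1 - j)) * schur1 p (\<nu>(j := \<nu> j + 1)) * schur1 p \<nu>)"
    by (rule sum.Sigma) (auto simp: finite_partitions)
  \<comment> \<open>A box has the same weight seen from the smaller shape, where it is added, and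
    from the larger one, where it is removed.\<close>
  also have "\<dots> = (\<Sum>(\<nu>, j)\<in>Sigma (partitions p (Suc n)) (removable p).
       real (\<nu> j + (p - 1 - j)) * schur1 p \<nu> * schur1 p (\<nu>(j := \<nu> j - 1)))"
    by (rule sum.reindex_bij_witness[of _ "\<lambda>(\<nu>, j). (\<nu>(j := \<nu> j - 1), j)" "\<lambda>(\<nu>, j). (\<nu>(j := \<nu> j + 1), j)"])
      (auto simp: remove_box[simplified] add_box[simplified] removable_pos split: prod.splits)
  also have "\<dots> = (\<Sum>\<nu>\<in>partitions p (Suc n). \<Sum>j\<in>removable p \<nu>.
       real (\<nu> j + (p - 1 - j)) * schur1 p \<nu> * schur1 p (\<nu>(j := \<nu> j - 1)))"
    by (rule sum.Sigma[symmetric]) (auto simp: finite_partitions)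
  also have "\<dots> = real (Suc n) * (\<Sum>\<nu>\<in>partitions p (Suc n). (schur1 p \<nu>)\<^sup>2)"
    unfolding sum_distrib_left
  proof (intro sum.cong refl)
    fix \<nu> assume "\<nu> \<in> partitions p (Suc n)"
    from schur1_down[OF this]
    have "schur1 p \<nu> * (\<Sum>j\<in>removable p \<nu>. real (\<nu> j + (p - 1 - j)) * schur1 p (\<nu>(j := \<nu> j - 1))) =
       real (Suc n) * (schur1 p \<nu>)\<^sup>2"
      unfolding removable_def[symmetric] by (simp add: power2_eq_square)
    then show "(\<Sum>j\<in>removable p \<nu>. real (\<nu> j + (p - 1 - j)) * schur1 p \<nu> * schur1 p (\<nu>(j := \<nu> j - 1))) =
      real (Suc n) * (schur1 p \<nu>)\<^sup>2"
      unfolding sum_distrib_left by (simp only: mult_ac)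
  qed
  finally show ?thesis ..
qed

text \<open>On both sides the first value is 1 and consecutive values have the ratio (n + p^2) / (n
  + 1).\<close>

lemma sum_schur1_sq:
  assumes "p \<ge> 1"
  shows "(\<Sum>\<nu>\<in>partitions p n. (schur1 p \<nu>)\<^sup>2) = real (p\<^sup>2 - 1 + n choose n)"
proof (induction n)
  case 0
  show ?case by (simp add: partitions_0 schur1_zero)
next
  case (Suc n)
  have "Suc n * (p\<^sup>2 - 1 + Suc n choose Suc n) = (n + p\<^sup>2) * (p\<^sup>2 - 1 + n choose n)"
    using assms binomial_absorption[of n "p\<^sup>2 - 1 + Suc n"] by (simp add: Suc_times_binomial_eq)
  then have "real (Suc n) * real (p\<^sup>2 - 1 + Suc n choose Suc n) =
      (real n + (real p)\<^sup>2) * real (p\<^sup>2 - 1 + n choose n)"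
    by (metis of_nat_mult of_nat_add of_nat_power)
  also have "\<dots> = real (Suc n) * (\<Sum>\<nu>\<in>partitions p (Suc n). (schur1 p \<nu>)\<^sup>2)"
    unfolding sum_schur1_sq_Suc Suc ..
  finally show ?case by simp
qed

section \<open>Row insertion on Gelfand--Tsetlin patterns\<close>

text \<open>Row \<open>i\<close> of the shape formed by the entries \<open>\<le> z\<close>; this encodes a semistandard tableau
  as a Gelfand--Tsetlin pattern.\<close>

definition tableau_pattern :: "nat list list \<Rightarrow> nat \<Rightarrow> nat \<Rightarrow> nat" where
  "tableau_pattern t z i = (if i < length t then length (filter (\<lambda>y. y \<le> z) (t ! i)) else 0)"

text \<open>The row in which the shape at level \<open>z\<close> grows when \<open>x \<le> z\<close> is inserted.\<close>

primrec bump_path :: "nat \<Rightarrow> (nat \<Rightarrow> nat \<Rightarrow> nat) \<Rightarrow> nat \<Rightarrow> nat" where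
  "bump_path x g 0 = 0"
| "bump_path x g (Suc z) =
     (if Suc z \<le> x then 0
      else if g (Suc z) (bump_path x g z) = g z (bump_path x g z) then bump_path x g z
      else Suc (bump_path x g z))"

definition gt_insert :: "nat \<Rightarrow> (nat \<Rightarrow> nat \<Rightarrow> nat) \<Rightarrow> nat \<Rightarrow> nat \<Rightarrow> nat" where
  "gt_insert x g z = (if x \<le> z then (g z)(bump_path x g z := Suc (g z (bump_path x g z))) else g z)"

lemma row_insert_None:
  "sorted r \<Longrightarrow> row_insert x r = (None, r') \<Longrightarrow> r' = r @ [x] \<and> (\<forall>u\<in>set r. u \<le> x)"
  by (induction r arbitrary: r') (auto split: if_splits prod.splits)

text \<open>The last clause is the bookkeeping for patterns: the row gains \<open>x\<close> and
  loses \<open>y\<close>, counted at an arbitrary level \<open>z\<close>.\<close>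

lemma row_insert_Some:
  assumes "sorted r" "row_insert x r = (Some y, r')"
  shows "x < y" "y \<in> set r" "\<And>u. u \<in> set r \<Longrightarrow> u \<le> x \<or> y \<le> u"
    "length (filter (\<lambda>u. u \<le> z) r') + of_bool (y \<le> z) = length (filter (\<lambda>u. u \<le> z) r) + of_bool (x \<le> z)"
proof -
  have "x < y \<and> y \<in> set r \<and> (\<forall>u\<in>set r. u \<le> x \<or> y \<le> u) \<and>
    length (filter (\<lambda>u. u \<le> z) r') + of_bool (y \<le> z) = length (filter (\<lambda>u. u \<le> z) r) + of_bool (x \<le> z)"
    using assms
  proof (induction r arbitrary: r')
    case (Cons h ys)
    then show ?case by (auto split: if_splits prod.splits)
  qed simp
  then show "x < y" "y \<in> set r" "\<And>u. u \<in> set r \<Longrightarrow> u \<le> x \<or> y \<le> u"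
    "length (filter (\<lambda>u. u \<le> z) r') + of_bool (y \<le> z) = length (filter (\<lambda>u. u \<le> z) r) + of_bool (x \<le> z)"
    by auto
qed

lemma set_row_insert: "row_insert x r = (b, r') \<Longrightarrow> set r' \<union> set_option b = insert x (set r)"
proof (induction r arbitrary: r')
  case (Cons h ys)
  obtain b' zs where zs: "row_insert x ys = (b', zs)" by fastforce
  show ?case
  proof (cases "x < h")
    case True
    then show ?thesis using Cons.prems by auto
  next
    case False
    then have "b = b'" "r' = h # zs" using Cons.prems zs by auto
    then show ?thesis using Cons.IH zs by auto
  qed
qed auto

lemma sorted_row_insert: "sorted r \<Longrightarrow> row_insert x r = (b, r') \<Longrightarrow> sorted r'"
proof (induction r arbitrary: r')
  case (Cons h ys)
  show ?case
  proof (cases "x < h")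
    case False
    then obtain zs where zs: "row_insert x ys = (b, zs)" "r' = h # zs"
      using Cons.prems by (auto split: prod.splits)
    then have "set zs \<subseteq> insert x (set ys)" using set_row_insert[of x ys b zs] by auto
    then show ?thesis using zs Cons False by fastforce
  next
    case True
    then have "r' = x # ys" using Cons.prems(2) by simp
    then show ?thesis using Cons.prems(1) True by force
  qed
qed auto

lemma sorted_tableau_insert:
  "\<forall>r\<in>set t. sorted r \<Longrightarrow> \<forall>r\<in>set (tableau_insert x t). sorted r"
proof (induction t arbitrary: x)
  case (Cons r t)
  obtain b r' where br: "row_insert x r = (b, r')" by fastforce
  then have "sorted r'" using Cons.prems sorted_row_insert by auto
  then show ?case using Cons br by (cases b) auto
qed auto

lemma entries_tableau_insert:
  "\<Union>(set ` set (tableau_insert x t)) \<subseteq> insert x (\<Union>(set ` set t))"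
proof (induction t arbitrary: x)
  case (Cons r t)
  obtain b r' where br: "row_insert x r = (b, r')" by fastforce
  note set_row_insert[OF this]
  then show ?case using Cons.IH br by (cases b) fastforce+
qed auto

lemma tableau_pattern_Cons:
  "tableau_pattern (r # t) z 0 = length (filter (\<lambda>y. y \<le> z) r)"
  "tableau_pattern (r # t) z (Suc i) = tableau_pattern t z i"
  by (auto simp: tableau_pattern_def)

lemma filter_le_Suc:
  assumes "Suc z \<notin> set r"
  shows "filter (\<lambda>y. y \<le> Suc z) r = filter (\<lambda>y. y \<le> z) r"
  using assms by (intro filter_cong refl) (metis le_Suc_eq)

lemma length_filter_le_Suc:
  assumes "Suc z \<in> set r"
  shows "length (filter (\<lambda>y. y \<le> z) r) < length (filter (\<lambda>y. y \<le> Suc z) r)"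
proof -
  have "length (filter (\<lambda>y. y \<le> z) (filter (\<lambda>y. y \<le> Suc z) r)) < length (filter (\<lambda>y. y \<le> Suc z) r)"
    using assms by (intro length_filter_less[of "Suc z"]) auto
  also have "filter (\<lambda>y. y \<le> z) (filter (\<lambda>y. y \<le> Suc z) r) = filter (\<lambda>y. y \<le> z) r"
    by (auto intro!: filter_cong)
  finally show ?thesis .
qed

text \<open>A row contains the letter \<open>Suc z\<close> exactly where levels \<open>z\<close> and
  \<open>Suc z\<close> differ. If it does, the box gained at level \<open>z\<close> displaces such a
  letter and level \<open>Suc z\<close> grows one row lower; if not, both levels grow in this row.
  In the first row this happens at the level of the bumped letter \<open>y\<close>, and from there
  on the path is that of \<open>y\<close> in the remaining rows.\<close>

lemma tableau_pattern_insert: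
  assumes "\<forall>r\<in>set t. sorted r"
  shows "tableau_pattern (tableau_insert x t) = gt_insert x (tableau_pattern t)"
  using assms
proof (induction t arbitrary: x)
  case Nil
  have zero: "tableau_pattern [] = (\<lambda>_ _. 0)" by (simp add: tableau_pattern_def fun_eq_iff)
  have "bump_path x (\<lambda>_ _. 0) z = 0" for z by (induction z) auto
  then show ?case unfolding zero by (auto simp: gt_insert_def tableau_pattern_def fun_eq_iff)
next
  case (Cons r t)
  let ?g = "tableau_pattern (r # t)"
  obtain b r' where br: "row_insert x r = (b, r')" by fastforce
  have r: "sorted r" using Cons.prems by simp
  show ?case
  proof (cases b)
    case None
    note N = row_insert_None[OF r br[unfolded None]]
    have path: "bump_path x ?g z = 0" for z
    proof (induction z)
      case (Suc z)
      have "Suc z \<notin> set r" if "\<not> Suc z \<le> x" using N that by auto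
      then show ?case using Suc by (auto simp: tableau_pattern_Cons filter_le_Suc)
    qed simp
    have ins: "tableau_insert x (r # t) = (r @ [x]) # t" using br None N by simp
    show ?thesis
    proof (intro ext)
      fix z i show "tableau_pattern (tableau_insert x (r # t)) z i = gt_insert x ?g z i"
        unfolding ins gt_insert_def path by (cases i) (auto simp: tableau_pattern_Cons)
    qed
  next
    case (Some y)
    note S = row_insert_Some[OF r br[unfolded Some]]
    have path: "bump_path x ?g z = (if z < y then 0 else Suc (bump_path y (tableau_pattern t) z))" for z
    proof (induction z)
      case 0
      then show ?case using S(1) by simp
    next
      case (Suc z)
      consider "Suc z \<le> x" | "x < Suc z" "Suc z < y" | "Suc z = y" | "y < Suc z" by linarith
      then show ?case
      proof cases
        case 2
        then have "Suc z \<notin> set r" using S(3) by force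
        then show ?thesis using Suc 2 by (simp add: tableau_pattern_Cons filter_le_Suc)
      next
        case 3
        show ?thesis
          using 3[symmetric] Suc S(1) length_filter_le_Suc[of z r] S(2) by (simp add: tableau_pattern_Cons)
      next
        case 4
        then show ?thesis using Suc S(1) by (simp add: tableau_pattern_Cons)
      qed (use S(1) in simp)
    qed
    have ins: "tableau_insert x (r # t) = r' # tableau_insert y t" using br Some by simp
    have IH: "tableau_pattern (tableau_insert y t) = gt_insert y (tableau_pattern t)"
      using Cons by simp
    show ?thesis
    proof (intro ext)
      fix z i show "tableau_pattern (tableau_insert x (r # t)) z i = gt_insert x ?g z i"
        unfolding ins gt_insert_def path using S(1) S(4)[of z]
        by (cases i) (auto simp: tableau_pattern_Cons IH gt_insert_def)
    qed
  qed
qed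

section \<open>Insertion into patterns and its inverse\<close>

lemma gt_patterns_le:
  assumes "g \<in> gt_patterns p \<nu>" "z \<le> z'"
  shows "g z i \<le> g z' i"
proof (rule lift_Suc_mono_le[OF _ assms(2)])
  fix z show "g z i \<le> g (Suc z) i"
    using assms(1) by (cases "z < p") (auto simp: gt_patterns_def interlaces_def)
qed

text \<open>The path starts in row 0 at level \<open>x\<close> and descends at most one row per
  level. With \<open>1 \<le> x\<close> it is therefore still within the first \<open>p\<close> rows
  at level \<open>p\<close>.\<close>

lemma bump_path_le: "x \<le> z \<Longrightarrow> bump_path x g z \<le> z - x"
proof (induction z)
  case (Suc z)
  then show ?case by (cases "x \<le> z") (auto simp: Suc_diff_le)
qed simp

lemma bump_path_stable:
  assumes "g \<in> gt_patterns p \<nu>" "x \<le> p" "p \<le> z"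
  shows "bump_path x g z = bump_path x g p"
  using assms(3)
proof (induction z rule: dec_induct)
  case (step z)
  then show ?case using assms by (auto simp: gt_patterns_def)
qed simp

text \<open>If the path has just descended from row \<open>i\<close>, interlacing bounds the new row
  by \<open>g z i\<close>, which is less than \<open>g (Suc z) i\<close>. If it stays, its row has
  the same length at both levels while the row above can only grow.\<close>

lemma bump_path_addable:
  assumes "g \<in> gt_patterns p \<nu>" "1 \<le> x" "x \<le> z" "z \<le> p" "bump_path x g z \<noteq> 0"
  shows "g z (bump_path x g z) < g z (bump_path x g z - 1)"
  using assms(3-5)
proof (induction z rule: dec_induct)
  case base
  then show ?case using \<open>1 \<le> x\<close> by (cases x) auto
next
  case (step z)
  let ?i = "bump_path x g z"
  have il: "interlaces (g z) (g (Suc z))" using assms(1) step.prems by (auto simp: gt_patterns_def)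
  show ?case
  proof (cases "g (Suc z) ?i = g z ?i")
    case True
    then have "bump_path x g (Suc z) = ?i" using step.hyps by simp
    moreover have "g z (?i - 1) \<le> g (Suc z) (?i - 1)" using il by (auto simp: interlaces_def)
    moreover have "g z ?i < g z (?i - 1)" using step calculation(1) by simp
    ultimately show ?thesis using True by simp
  next
    case False
    then have "bump_path x g (Suc z) = Suc ?i" using step.hyps by simp
    moreover have "g (Suc z) (Suc ?i) \<le> g z ?i" "g z ?i \<le> g (Suc z) ?i" using il by (auto simp: interlaces_def)
    ultimately show ?thesis using False by simp
  qed
qed

text \<open>Two kinds of new boxes could break the interlacing. When the path stays in row
  \<open>i\<close>, the box at level \<open>Suc z\<close> must not overtake row \<open>i - 1\<close>
  of level \<open>z\<close>, which \<open>bump_path_addable\<close> prevents. When it descends, the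
  box at level \<open>z\<close> fits because level \<open>Suc z\<close> is strictly longer in the
  row that is left.\<close>

lemma gt_insert_in_gt_patterns:
  assumes g: "g \<in> gt_patterns p \<nu>" and x: "1 \<le> x" "x \<le> p"
  shows "gt_insert x g \<in> gt_patterns p (\<nu>(bump_path x g p := \<nu> (bump_path x g p) + 1))"
    and "bump_path x g p \<in> addable p \<nu>"
proof -
  show "bump_path x g p \<in> addable p \<nu>"
    using bump_path_le[of x p g] bump_path_addable[OF g x(1) x(2)] x g
    by (auto simp: addable_def gt_patterns_def)
  have "interlaces (gt_insert x g z) (gt_insert x g (Suc z))" if z: "z < p" for z
  proof -
    let ?i = "bump_path x g z"
    have il: "interlaces (g z) (g (Suc z))" using g z by (auto simp: gt_patterns_def)
    consider "Suc z < x" | "Suc z = x" | "x \<le> z" by linarith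
    then show ?thesis
    proof cases
      case 1
      then show ?thesis using il by (simp add: gt_insert_def)
    next
      case 2
      from this[symmetric] have "bump_path x g (Suc z) = 0" by simp
      then show ?thesis using il 2 by (auto simp: gt_insert_def interlaces_def le_SucI)
    next
      case 3
      show ?thesis
      proof (cases "g (Suc z) ?i = g z ?i")
        case True
        then have eq: "bump_path x g (Suc z) = ?i" using 3 by simp
        have "Suc (g z ?i) \<le> g z k" if "Suc k = ?i" for k
          using bump_path_addable[OF g x(1) 3] z that[symmetric] by auto
        moreover have "g (Suc z) (Suc k) \<le> g z k" "g z k \<le> g (Suc z) k" for k
          using il by (auto simp: interlaces_def)
        ultimately show ?thesis using 3 True
          by (auto simp: gt_insert_def eq interlaces_def le_SucI Suc_leI simp del: bump_path.simps)
      next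
        case False
        then have eq: "bump_path x g (Suc z) = Suc ?i" using 3 by simp
        have "g z ?i < g (Suc z) ?i" using False il by (auto simp: interlaces_def intro: le_neq_implies_less)
        then show ?thesis using 3 il
          by (auto simp: gt_insert_def eq interlaces_def le_SucI simp del: bump_path.simps)
      qed
    qed
  qed
  moreover have "gt_insert x g z = \<nu>(bump_path x g p := \<nu> (bump_path x g p) + 1)" if "z \<ge> p" for z
    using bump_path_stable[OF g x(2) that] that g x by (simp add: gt_insert_def gt_patterns_def)
  moreover have "gt_insert x g 0 = (\<lambda>_. 0)" using g x by (simp add: gt_insert_def gt_patterns_def)
  ultimately show "gt_insert x g \<in> gt_patterns p (\<nu>(bump_path x g p := \<nu> (bump_path x g p) + 1))"
    by (auto simp: gt_patterns_def)
qed

lemma bump_path_cong: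
  "(\<And>z'. z' \<le> z \<Longrightarrow> g z' = h z') \<Longrightarrow> bump_path x g z = bump_path x h z"
  by (induction z) auto

lemma gt_insert_cong:
  "(\<And>z'. z' \<le> z \<Longrightarrow> g z' = h z') \<Longrightarrow> gt_insert x g z = gt_insert x h z"
  by (simp add: gt_insert_def bump_path_cong[of z g h])

lemma gt_patterns_extend:
  assumes "h \<in> gt_patterns p \<mu>" "interlaces \<mu> \<nu>"
  shows "(\<lambda>z. if z \<le> p then h z else \<nu>) \<in> gt_patterns (Suc p) \<nu>"
  using assms by (auto simp: gt_patterns_def less_Suc_eq)

text \<open>Reverse insertion, read off the pattern from the top level downwards.\<close>

lemma gt_insert_surj:
  assumes "g' \<in> gt_patterns p \<nu>" "j \<in> removable p \<nu>"
  shows "\<exists>x g. 1 \<le> x \<and> x \<le> p \<and> g \<in> gt_patterns p (\<nu>(j := \<nu> j - 1)) \<and>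
    bump_path x g p = j \<and> gt_insert x g = g'"
  using assms
proof (induction p arbitrary: g' \<nu> j)
  case 0
  then show ?case by (simp add: removable_def)
next
  case (Suc p)
  let ?\<mu> = "g' p" and ?\<nu>' = "\<nu>(j := \<nu> j - 1)"
  let ?h' = "\<lambda>z. if z \<le> p then g' z else g' p"
  let ?ext = "\<lambda>h z. if z \<le> p then h z else ?\<nu>'"
  have top: "g' z = \<nu>" if "z > p" for z using Suc.prems(1) that by (auto simp: gt_patterns_def)
  have il: "\<nu> (Suc k) \<le> ?\<mu> k" "?\<mu> k \<le> \<nu> k" for k
    using Suc.prems(1) top[of "Suc p"] by (auto simp: gt_patterns_def interlaces_def)
  have h': "?h' \<in> gt_patterns p ?\<mu>"
    using Suc.prems(1) by (auto simp: gt_patterns_def)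
  have supp: "i < p" if "?\<mu> i > 0" for i
    using gt_patterns_support[OF Suc.prems(1), of p i] that by (cases "i < p") auto
  have j: "\<nu> (Suc j) < \<nu> j" using Suc.prems(2) by (simp add: removable_def)
  have ind: ?case if i: "i \<in> removable p ?\<mu>" and il': "interlaces (?\<mu>(i := ?\<mu> i - 1)) ?\<nu>'"
    and step: "(if ?\<nu>' i = ?\<mu> i - 1 then i else Suc i) = j" for i
  proof -
    obtain x h where xh: "1 \<le> x" "x \<le> p" "h \<in> gt_patterns p (?\<mu>(i := ?\<mu> i - 1))"
      "bump_path x h p = i" "gt_insert x h = ?h'"
      using Suc.IH[OF h' i] by blast
    have g: "?ext h \<in> gt_patterns (Suc p) ?\<nu>'"
      by (rule gt_patterns_extend[OF xh(3) il'])
    have "bump_path x (?ext h) p = i"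
      unfolding xh(4)[symmetric] by (rule bump_path_cong) simp
    then have "bump_path x (?ext h) (Suc p) = (if ?\<nu>' i = h p i then i else Suc i)"
      using xh(2) by (simp del: fun_upd_apply)
    also have "h p i = ?\<mu> i - 1" using xh(3) by (simp add: gt_patterns_def)
    finally have path: "bump_path x (?ext h) (Suc p) = j" unfolding step .
    have "gt_insert x (?ext h) z = g' z" for z
    proof (cases "z \<le> p")
      case True
      then have "gt_insert x (?ext h) z = gt_insert x h z" by (intro gt_insert_cong) simp
      then show ?thesis using xh(5) True by simp
    next
      case False
      then have "bump_path x (?ext h) z = j"
        using bump_path_stable[OF g, of x z] xh(2) path by simp
      then show ?thesis using False xh(2) j top[of z] by (auto simp: gt_insert_def)
    qed
    then show ?thesis using xh(1,2) g path
      by (intro exI[of _ x] exI[of _ "?ext h"] conjI ext) (simp_all del: fun_upd_apply bump_path.simps)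
  qed
  \<comment> \<open>If levels \<open>p\<close> and \<open>Suc p\<close> of the result agree in row
    \<open>j\<close>, the path stayed there in its last step. Otherwise it entered row
    \<open>j\<close> at the top level: for \<open>j = 0\<close> by insertion of the letter
    \<open>Suc p\<close>, for \<open>j = Suc i\<close> by descending from row
    \<open>i\<close>.\<close>
  show ?case
  proof (cases "\<nu> j = ?\<mu> j")
    case True
    have "j \<in> removable p ?\<mu>"
      using supp[of j] il(1)[of "Suc j"] il(2)[of "Suc j"] j True by (auto simp: removable_def)
    moreover have "interlaces (?\<mu>(j := ?\<mu> j - 1)) ?\<nu>'"
      unfolding interlaces_def
    proof
      fix k show "?\<nu>' (Suc k) \<le> (?\<mu>(j := ?\<mu> j - 1)) k \<and> (?\<mu>(j := ?\<mu> j - 1)) k \<le> ?\<nu>' k"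
        using il[of k] il[of "Suc k"] j True by auto
    qed
    ultimately show ?thesis using True by (intro ind[of j]) auto
  next
    case False
    then have lt: "?\<mu> j < \<nu> j" using il(2)[of j] by simp
    show ?thesis
    proof (cases j)
      case 0
      let ?g = "?ext g'"
      have "interlaces ?\<mu> ?\<nu>'"
        unfolding interlaces_def
      proof
        fix k show "?\<nu>' (Suc k) \<le> ?\<mu> k \<and> ?\<mu> k \<le> ?\<nu>' k"
          using il[of k] lt 0 by auto
      qed
      from gt_patterns_extend[OF h' this]
      have g: "?g \<in> gt_patterns (Suc p) ?\<nu>'" by (simp cong: if_cong)
      have "gt_insert (Suc p) ?g z = g' z" for z
      proof (cases "z \<le> p")
        case False
        then have "bump_path (Suc p) ?g z = 0"
          using bump_path_stable[OF g, of "Suc p" z] by simp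
        then show ?thesis using False j 0 top[of z] by (auto simp: gt_insert_def)
      qed (simp add: gt_insert_def)
      then show ?thesis using g 0
        by (intro exI[of _ "Suc p"] exI[of _ ?g] conjI ext) (simp_all del: fun_upd_apply)
    next
      case (Suc i)
      have "i \<in> removable p ?\<mu>"
        using il(1)[of i] lt supp[of i] Suc by (auto simp: removable_def)
      moreover have "interlaces (?\<mu>(i := ?\<mu> i - 1)) ?\<nu>'"
        unfolding interlaces_def
      proof
        fix k show "?\<nu>' (Suc k) \<le> (?\<mu>(i := ?\<mu> i - 1)) k \<and> (?\<mu>(i := ?\<mu> i - 1)) k \<le> ?\<nu>' k"
          using il[of k] il[of "Suc k"] lt Suc by auto
      qed
      moreover have "?\<mu> i - 1 < \<nu> i" using il(1)[of i] il(2)[of i] lt Suc by auto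
      ultimately show ?thesis using Suc by (intro ind[of i]) auto
    qed
  qed
qed

text \<open>Assuming interlacing only for the levels up to \<open>p\<close>, instead of membership
  in \<open>gt_patterns\<close>, allows the induction to keep \<open>g\<close> and \<open>h\<close>
  and merely drop the top level, which is recovered first.\<close>

lemma gt_insert_inj:
  assumes g: "\<And>z. z < p \<Longrightarrow> interlaces (g z) (g (Suc z))"
    and h: "\<And>z. z < p \<Longrightarrow> interlaces (h z) (h (Suc z))"
    and "1 \<le> x" "x \<le> p" "1 \<le> y" "y \<le> p"
    and "bump_path x g p = bump_path y h p"
    and "\<And>z. z \<le> p \<Longrightarrow> gt_insert x g z = gt_insert y h z"
  shows "x = y \<and> (\<forall>z\<le>p. g z = h z)"
  using assms
proof (induction p)
  case 0
  then show ?case by simp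
next
  case (Suc p)
  have fun_upd_Suc_inj: "f(i := Suc (f i)) = f'(i := Suc (f' i)) \<Longrightarrow> f = f'" for f f' :: "nat \<Rightarrow> nat" and i
    by (metis fun_upd_eqD fun_upd_triv fun_upd_upd nat.inject)
  have "(g (Suc p))(bump_path x g (Suc p) := Suc (g (Suc p) (bump_path x g (Suc p)))) =
      (h (Suc p))(bump_path x g (Suc p) := Suc (h (Suc p) (bump_path x g (Suc p))))"
    using Suc.prems(8)[of "Suc p"] Suc.prems(4,6,7)
    by (simp add: gt_insert_def del: bump_path.simps fun_upd_apply)
  then have top: "g (Suc p) = h (Suc p)" by (rule fun_upd_Suc_inj)
  let ?j = "bump_path x g (Suc p)"
  have mono: "g p k \<le> g (Suc p) k" "h p k \<le> h (Suc p) k" for k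
    using Suc.prems(1,2)[of p] by (auto simp: interlaces_def)
  \<comment> \<open>Whether the path moved at the top level is visible in the pattern after the insertion.\<close>
  have stay: "x' \<le> p \<and> bump_path x' f p = bump_path x' f (Suc p) \<longleftrightarrow>
       gt_insert x' f p (bump_path x' f (Suc p)) = gt_insert x' f (Suc p) (bump_path x' f (Suc p))"
    if "\<And>k. f p k \<le> f (Suc p) k" "x' \<le> Suc p" for x' f
    using that(1)[of "bump_path x' f (Suc p)"] that(2)
    by (auto simp: gt_insert_def le_Suc_eq split: if_splits)
  have eq: "gt_insert x g p = gt_insert y h p" "gt_insert x g (Suc p) = gt_insert y h (Suc p)"
    using Suc.prems(8) by auto
  have same: "x \<le> p \<and> bump_path x g p = ?j \<longleftrightarrow> y \<le> p \<and> bump_path y h p = ?j"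
    using stay[of g x, OF mono(1) Suc.prems(4)] stay[of h y, OF mono(2) Suc.prems(6)] eq Suc.prems(7)
    by simp
  \<comment> \<open>If the path was not in row \<open>?j\<close> at level \<open>p\<close>, then
    \<open>?j\<close> itself tells what happened: it is 0 when the top letter was inserted and
    positive after a descent. Hence both insertions made the same kind of last step.\<close>
  have move: "bump_path x' f p \<noteq> bump_path x' f (Suc p) \<Longrightarrow> x' \<le> p \<Longrightarrow> bump_path x' f (Suc p) = Suc (bump_path x' f p)"
    "x' = Suc p \<Longrightarrow> bump_path x' f (Suc p) = 0" for x' f
    by (auto split: if_splits)
  consider "x \<le> p" "y \<le> p" "bump_path x g p = bump_path y h p" | "x = Suc p" "y = Suc p"
    using same move[of x g] move[of y h] Suc.prems(4,6,7) by (metis le_Suc_eq nat.inject nat.distinct(1))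
  then show ?case
  proof cases
    case 1
    have "x = y \<and> (\<forall>z\<le>p. g z = h z)"
      by (rule Suc.IH) (use Suc.prems 1 in auto)
    then show ?thesis using top by (auto simp: le_Suc_eq)
  next
    case 2
    have "g z = h z" if "z \<le> p" for z
      using Suc.prems(8)[of z] that 2 by (simp add: gt_insert_def)
    then show ?thesis using top 2 by (auto simp: le_Suc_eq)
  qed
qed

lemma gt_insert_unique:
  assumes "g \<in> gt_patterns p \<nu>" "h \<in> gt_patterns p \<nu>" "1 \<le> x" "x \<le> p" "1 \<le> y" "y \<le> p"
    and "bump_path x g p = bump_path y h p" "gt_insert x g = gt_insert y h"
  shows "x = y" "g = h"
proof -
  have *: "x = y \<and> (\<forall>z\<le>p. g z = h z)"
    using assms by (intro gt_insert_inj) (auto simp: gt_patterns_def)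
  then show "x = y" by simp
  show "g = h"
  proof
    fix z show "g z = h z"
      using * assms(1,2) by (cases "z \<le> p") (auto simp: gt_patterns_def)
  qed
qed

section \<open>Words counted by pattern and by shape\<close>

definition word_pattern :: "nat list \<Rightarrow> nat \<Rightarrow> nat \<Rightarrow> nat" where
  "word_pattern w = tableau_pattern (rsk_tableau w)"

lemma rsk_tableau_snoc: "rsk_tableau (w @ [x]) = tableau_insert x (rsk_tableau w)"
  by (simp add: rsk_tableau_def)

lemma sorted_rsk_tableau: "\<forall>r\<in>set (rsk_tableau w). sorted r"
proof (induction w rule: rev_induct)
  case (snoc x w)
  show ?case unfolding rsk_tableau_snoc by (rule sorted_tableau_insert[OF snoc])
qed (simp add: rsk_tableau_def)

lemma entries_rsk_tableau: "\<Union>(set ` set (rsk_tableau w)) \<subseteq> set w"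
proof (induction w rule: rev_induct)
  case (snoc x w)
  have "\<Union>(set ` set (rsk_tableau (w @ [x]))) \<subseteq> insert x (\<Union>(set ` set (rsk_tableau w)))"
    unfolding rsk_tableau_snoc by (rule entries_tableau_insert)
  also have "\<dots> \<subseteq> set (w @ [x])" using snoc by auto
  finally show ?case .
qed (simp add: rsk_tableau_def)

lemma word_pattern_snoc: "word_pattern (w @ [x]) = gt_insert x (word_pattern w)"
  unfolding word_pattern_def rsk_tableau_snoc
  by (rule tableau_pattern_insert[OF sorted_rsk_tableau])

lemma word_pattern_Nil: "word_pattern [] = (\<lambda>_ _. 0)"
  by (simp add: word_pattern_def rsk_tableau_def tableau_pattern_def fun_eq_iff)

lemma words_Suc: "words (Suc n) p = (\<lambda>(w, x). w @ [x]) ` (words n p \<times> {1..p})"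
proof
  show "words (Suc n) p \<subseteq> (\<lambda>(w, x). w @ [x]) ` (words n p \<times> {1..p})"
  proof
    fix v assume v: "v \<in> words (Suc n) p"
    then obtain w x where "v = w @ [x]" by (cases v rule: rev_cases) (auto simp: words_def)
    then show "v \<in> (\<lambda>(w, x). w @ [x]) ` (words n p \<times> {1..p})"
      using v by (auto simp: words_def intro!: image_eqI[of _ _ "(w, x)"])
  qed
qed (auto simp: words_def)

lemma word_pattern_in_gt_patterns:
  assumes "w \<in> words n p"
  shows "word_pattern w \<in> gt_patterns p (word_pattern w p) \<and> word_pattern w p \<in> partitions p n"
  using assms
proof (induction n arbitrary: w)
  case 0
  then have "w = []" by (simp add: words_def)
  then show ?case
    by (auto simp: word_pattern_Nil gt_patterns_def partitions_0 interlaces_def)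
next
  case (Suc n)
  then obtain v x where vx: "w = v @ [x]" "v \<in> words n p" "1 \<le> x" "x \<le> p"
    by (auto simp: words_Suc)
  note IH = Suc.IH[OF vx(2)]
  note ins = gt_insert_in_gt_patterns[OF conjunct1[OF IH] vx(3,4)]
  have "gt_insert x (word_pattern v) p =
      (word_pattern v p)(bump_path x (word_pattern v) p := word_pattern v p (bump_path x (word_pattern v) p) + 1)"
    using vx(4) by (simp add: gt_insert_def)
  then show ?case
    unfolding vx(1) word_pattern_snoc using ins add_box(1)[OF conjunct2[OF IH] ins(2)]
    by (simp del: fun_upd_apply)
qed

text \<open>Reverse the last insertion: for each corner \<open>j\<close>, exactly one letter and one
  smaller pattern lead to \<open>g\<close> along a path that ends in row \<open>j\<close>. The
  corners met in this way encode the recording tableau, so the count obeys the recursion of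
  \<open>syt_count\<close> and depends on \<open>g\<close> only through its shape.\<close>

lemma card_words_with_pattern:
  assumes "g \<in> gt_patterns p \<nu>" "\<nu> \<in> partitions p n"
  shows "card {w \<in> words n p. word_pattern w = g} = syt_count p n \<nu>"
  using assms
proof (induction n arbitrary: g \<nu>)
  case 0
  have "g = (\<lambda>_ _. 0)"
  proof (intro ext)
    fix z i
    have "g z i \<le> g (max z p) i" by (rule gt_patterns_le[OF 0(1)]) simp
    also have "\<dots> = 0" using 0 by (simp add: gt_patterns_def partitions_0)
    finally show "g z i = 0" by simp
  qed
  then have "{w \<in> words 0 p. word_pattern w = g} = {[]}"
    by (auto simp: words_def word_pattern_Nil)
  then show ?case by simp
next
  case (Suc n)
  define S where "S j = {v \<in> words (Suc n) p. word_pattern v = g \<and>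
      (\<exists>w x. v = w @ [x] \<and> bump_path x (word_pattern w) p = j)}" for j
  have "card (S j) = syt_count p n (\<nu>(j := \<nu> j - 1))" if j: "j \<in> removable p \<nu>" for j
  proof -
    obtain x h where xh: "1 \<le> x" "x \<le> p" "h \<in> gt_patterns p (\<nu>(j := \<nu> j - 1))"
      "bump_path x h p = j" "gt_insert x h = g"
      using gt_insert_surj[OF Suc.prems(1) j] by blast
    have "S j = (\<lambda>w. w @ [x]) ` {w \<in> words n p. word_pattern w = h}"
    proof (intro equalityI subsetI)
      fix v assume "v \<in> S j"
      then obtain w y where wy: "v = w @ [y]" "w \<in> words n p" "1 \<le> y" "y \<le> p"
          "gt_insert y (word_pattern w) = g" "bump_path y (word_pattern w) p = j"
        by (auto simp: S_def words_Suc word_pattern_snoc)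
      have wp: "word_pattern w \<in> gt_patterns p (word_pattern w p)"
        using word_pattern_in_gt_patterns[OF wy(2)] by simp
      have "g p = \<nu>" using Suc.prems(1) by (simp add: gt_patterns_def)
      then have "word_pattern w p = \<nu>(j := \<nu> j - 1)"
        using wy(4-6) by (auto simp: gt_insert_def)
      then show "v \<in> (\<lambda>w. w @ [x]) ` {w \<in> words n p. word_pattern w = h}"
        using gt_insert_unique[OF _ xh(3) wy(3,4) xh(1,2), of "word_pattern w"] wp wy xh by auto
    next
      fix v assume "v \<in> (\<lambda>w. w @ [x]) ` {w \<in> words n p. word_pattern w = h}"
      then show "v \<in> S j"
        using xh by (auto simp: S_def words_Suc word_pattern_snoc)
    qed
    moreover have "inj_on (\<lambda>w. w @ [x]) {w \<in> words n p. word_pattern w = h}"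
      by (auto simp: inj_on_def)
    ultimately show ?thesis
      using Suc.IH[OF xh(3) remove_box(1)[OF Suc.prems(2) j]] by (simp only: card_image)
  qed
  moreover have "{w \<in> words (Suc n) p. word_pattern w = g} = (\<Union>j\<in>removable p \<nu>. S j)"
  proof (intro equalityI subsetI)
    fix v assume "v \<in> {w \<in> words (Suc n) p. word_pattern w = g}"
    then have v: "v \<in> words (Suc n) p" "word_pattern v = g" by auto
    then obtain w x where wx: "v = w @ [x]" "w \<in> words n p" "1 \<le> x" "x \<le> p"
      by (auto simp: words_Suc)
    have ins: "gt_insert x (word_pattern w) = g" using v(2) wx(1) by (simp add: word_pattern_snoc)
    let ?j = "bump_path x (word_pattern w) p"
    note wp = word_pattern_in_gt_patterns[OF wx(2)]
    have "?j \<in> addable p (word_pattern w p)"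
      using gt_insert_in_gt_patterns(2)[OF conjunct1[OF wp] wx(3,4)] .
    from add_box(2)[OF conjunct2[OF wp] this]
    have "?j \<in> removable p (gt_insert x (word_pattern w) p)"
      using wx(4) by (simp add: gt_insert_def)
    then have "?j \<in> removable p \<nu>"
      using ins Suc.prems(1) by (simp add: gt_patterns_def)
    then show "v \<in> (\<Union>j\<in>removable p \<nu>. S j)"
      using wx v by (auto simp: S_def word_pattern_snoc intro!: bexI[of _ ?j])
  qed (auto simp: S_def)
  moreover have "card (\<Union>j\<in>removable p \<nu>. S j) = (\<Sum>j\<in>removable p \<nu>. card (S j))"
    by (rule card_UN_disjoint) (auto simp: S_def finite_words)
  ultimately show ?case by simp
qed

lemma card_words_with_shape:
  assumes "\<nu> \<in> partitions p n"
  shows "real (card {w \<in> words n p. word_pattern w p = \<nu>}) = real (syt_count p n \<nu>) * schur1 p \<nu>"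
proof -
  have \<nu>: "finite (gt_patterns p \<nu>)" "real (card (gt_patterns p \<nu>)) = schur1 p \<nu>"
    using card_gt_patterns[of \<nu> p] assms by (auto simp: partitions_def)
  have "{w \<in> words n p. word_pattern w p = \<nu>} =
      (\<Union>g\<in>gt_patterns p \<nu>. {w \<in> words n p. word_pattern w = g})"
    (is "?A = ?B")
  proof (intro equalityI subsetI)
    fix w assume "w \<in> ?A"
    then show "w \<in> ?B" using word_pattern_in_gt_patterns[of w n p] by auto
  qed (auto simp: gt_patterns_def)
  also have "card \<dots> = (\<Sum>g\<in>gt_patterns p \<nu>. card {w \<in> words n p. word_pattern w = g})"
    by (rule card_UN_disjoint) (auto simp: \<nu> finite_words)
  also have "\<dots> = (\<Sum>g\<in>gt_patterns p \<nu>. syt_count p n \<nu>)"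
    by (intro sum.cong refl card_words_with_pattern assms)
  finally show ?thesis by (simp flip: \<nu>(2))
qed

text \<open>No letter exceeds \<open>p\<close>, so level \<open>p\<close> counts whole rows. Parts
  are numbered from 1, rows of the pattern from 0.\<close>

lemma shape_part_rsk_shape:
  assumes "w \<in> words n p" "p \<ge> 1"
  shows "shape_part (rsk_shape w) p = word_pattern w p (p - 1)"
proof (cases "p \<le> length (rsk_tableau w)")
  case True
  let ?r = "rsk_tableau w ! (p - 1)"
  have "?r \<in> set (rsk_tableau w)" using True assms(2) by simp
  then have "set ?r \<subseteq> set w" using entries_rsk_tableau[of w] by blast
  then have "set ?r \<subseteq> {1..p}" using assms(1) by (auto simp: words_def)
  then have "filter (\<lambda>y. y \<le> p) ?r = ?r" by (auto simp: filter_id_conv)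
  then show ?thesis
    using True assms(2) by (simp add: shape_part_def rsk_shape_def word_pattern_def tableau_pattern_def)
next
  case False
  then show ?thesis
    using assms(2) by (auto simp: shape_part_def rsk_shape_def word_pattern_def tableau_pattern_def)
qed

section \<open>Greene's theorem for the last row\<close>

text \<open>A letter \<open>x\<close> prolongs one of the chains \<open>p > \<dots> > x + 1\<close> that does not yet
  contain an \<open>x\<close>, if there is one; entry \<open>x\<close> counts the chains \<open>p > \<dots> > x\<close>.\<close>

definition chain_step :: "nat \<Rightarrow> nat \<Rightarrow> (nat \<Rightarrow> nat) \<Rightarrow> nat \<Rightarrow> nat" where
  "chain_step p x V = V(x := if x < p then min (Suc (V x)) (V (Suc x)) else Suc (V x))"

abbreviation chain_steps :: "nat \<Rightarrow> nat list \<Rightarrow> (nat \<Rightarrow> nat) \<Rightarrow> nat \<Rightarrow> nat" where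
  "chain_steps p w V \<equiv> fold (chain_step p) w V"

definition chain_count :: "nat \<Rightarrow> nat list \<Rightarrow> nat \<Rightarrow> nat" where
  "chain_count p w = chain_steps p w (\<lambda>_. 0)"

section \<open>Invariance of the chain process under the Knuth relations\<close>

definition chain_mono :: "nat \<Rightarrow> (nat \<Rightarrow> nat) \<Rightarrow> bool" where
  "chain_mono p V \<longleftrightarrow> (\<forall>x<p. V x \<le> V (Suc x))"

lemma chain_mono_step: "chain_mono p V \<Longrightarrow> chain_mono p (chain_step p x V)"
  unfolding chain_mono_def
proof (intro allI impI)
  fix y assume *: "\<forall>x<p. V x \<le> V (Suc x)" and y: "y < p"
  then have "V y \<le> V (Suc y)" "Suc y < p \<Longrightarrow> V (Suc y) \<le> V (Suc (Suc y))" by auto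
  then show "chain_step p x V y \<le> chain_step p x V (Suc y)"
    using y by (auto simp: chain_step_def)
qed

lemma chain_mono_steps: "chain_mono p V \<Longrightarrow> chain_mono p (chain_steps p w V)"
  by (induction w arbitrary: V) (auto simp: chain_mono_step)

lemma chain_mono_count: "chain_mono p (chain_count p w)"
  unfolding chain_count_def by (rule chain_mono_steps) (simp add: chain_mono_def)

lemma chain_step_ge: "chain_mono p V \<Longrightarrow> V y \<le> chain_step p x V y"
  by (auto simp: chain_mono_def chain_step_def)

lemma chain_steps_ge: "chain_mono p V \<Longrightarrow> V y \<le> chain_steps p w V y"
proof (induction w arbitrary: V)
  case (Cons x w)
  have "V y \<le> chain_step p x V y" by (rule chain_step_ge[OF Cons.prems])
  also have "\<dots> \<le> chain_steps p w (chain_step p x V) y"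
    by (rule Cons.IH[OF chain_mono_step[OF Cons.prems]])
  finally show ?case by simp
qed simp

lemma chain_steps_other: "y \<notin> set w \<Longrightarrow> chain_steps p w V y = V y"
  by (induction w arbitrary: V) (auto simp: chain_step_def)

text \<open>A letter \<open>x\<close> writes entry \<open>x\<close> and otherwise reads only entry
  \<open>Suc x\<close>, so only neighbouring letters interact.\<close>

lemma chain_step_commute:
  "c \<noteq> Suc a \<Longrightarrow> a \<noteq> Suc c \<Longrightarrow> chain_step p a (chain_step p c V) = chain_step p c (chain_step p a V)"
  by (cases "a = c") (auto simp: chain_step_def fun_upd_twist)

text \<open>Only \<open>c = Suc a\<close>, where \<open>b = c\<close>, needs an argument. After the
  first \<open>b\<close>, entry \<open>b\<close> either has grown, so that it exceeds entry
  \<open>a\<close>, or is stopped by entry \<open>Suc b\<close>, so that a second \<open>b\<close>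
  has no effect. In both cases the second \<open>b\<close> does not influence what \<open>a\<close>
  does.\<close>

lemma chain_steps_knuth1:
  assumes "a < b" "b \<le> c" "chain_mono p V"
  shows "chain_steps p [b, c, a] V = chain_steps p [b, a, c] V"
proof (cases "c = Suc a")
  case True
  then have "b = c" using assms by simp
  moreover have "a < p \<Longrightarrow> V a \<le> V (Suc a)" "Suc a < p \<Longrightarrow> V (Suc a) \<le> V (Suc (Suc a))"
    using assms(3) by (auto simp: chain_mono_def)
  ultimately show ?thesis using True by (auto simp: chain_step_def fun_eq_iff min_def)
next
  case False
  then show ?thesis using assms by (simp add: chain_step_commute)
qed

text \<open>In the critical case \<open>c = Suc a\<close>, \<open>b = a\<close>, the letter
  \<open>c\<close> raises entry \<open>c\<close> by at most one. The bound that the first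
  \<open>a\<close> meets before \<open>c\<close> is therefore absorbed by the bound that the second
  \<open>a\<close> meets after it.\<close>

lemma chain_steps_knuth2:
  assumes "a \<le> b" "b < c" "chain_mono p V"
  shows "chain_steps p [a, c, b] V = chain_steps p [c, a, b] V"
proof (cases "c = Suc a")
  case True
  then have "b = a" using assms by simp
  moreover have "a < p \<Longrightarrow> V a \<le> V (Suc a)" "Suc a < p \<Longrightarrow> V (Suc a) \<le> V (Suc (Suc a))"
    using assms(3) by (auto simp: chain_mono_def)
  ultimately show ?thesis using True by (auto simp: chain_step_def fun_eq_iff min_def)
next
  case False
  then show ?thesis using assms by (simp add: chain_step_commute)
qed

lemma chain_steps_move_left:
  assumes "sorted (h # ys)" "x < h" "chain_mono p V"
  shows "chain_steps p (h # ys @ [x]) V = chain_steps p (h # x # ys) V"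
  using assms
proof (induction ys arbitrary: h V)
  case (Cons u us)
  have "chain_steps p (u # us @ [x]) (chain_step p h V) = chain_steps p (u # x # us) (chain_step p h V)"
    using Cons.prems by (intro Cons.IH chain_mono_step) auto
  then have "chain_steps p (h # (u # us) @ [x]) V = chain_steps p us (chain_steps p [h, u, x] V)" by simp
  also have "chain_steps p [h, u, x] V = chain_steps p [h, x, u] V"
    using Cons.prems by (intro chain_steps_knuth1) auto
  finally show ?case by simp
qed simp

text \<open>Row insertion is a sequence of Knuth moves: \<open>x\<close> travels left until it
  stands right behind the letter \<open>y\<close> that it replaces, and then \<open>y\<close>
  travels to the front across the letters before it.\<close>

lemma chain_steps_row_insert:
  assumes "sorted r" "row_insert x r = (Some y, r')" "chain_mono p V"
  shows "chain_steps p (r @ [x]) V = chain_steps p (y # r') V"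
  using assms
proof (induction r arbitrary: r' V)
  case (Cons h ys)
  show ?case
  proof (cases "x < h")
    case True
    then show ?thesis using Cons.prems chain_steps_move_left[of h ys x p V] by auto
  next
    case False
    then obtain zs where zs: "row_insert x ys = (Some y, zs)" "r' = h # zs"
      using Cons.prems by (auto split: prod.splits)
    then obtain z zs' where z: "zs = z # zs'" "h \<le> z" "z < y"
      using Cons.prems(1) False row_insert_Some(1)[OF _ zs(1)]
      by (cases ys) (auto split: if_splits prod.splits)
    have "chain_steps p ((h # ys) @ [x]) V = chain_steps p (ys @ [x]) (chain_step p h V)" by simp
    also have "\<dots> = chain_steps p (y # zs) (chain_step p h V)"
      using Cons.prems zs by (intro Cons.IH chain_mono_step) auto
    also have "\<dots> = chain_steps p zs' (chain_steps p [h, y, z] V)" by (simp add: z)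
    also have "chain_steps p [h, y, z] V = chain_steps p [y, h, z] V"
      using z Cons.prems by (intro chain_steps_knuth2) auto
    finally show ?thesis using z zs by simp
  qed
qed simp

text \<open>Rows are read from the bottom up, so a letter bumped out of the first row stands
  directly behind the word of the rows below, where its own insertion takes place.\<close>

lemma chain_steps_tableau_insert:
  assumes "\<forall>r\<in>set t. sorted r" "chain_mono p V"
  shows "chain_steps p (concat (rev t) @ [x]) V = chain_steps p (concat (rev (tableau_insert x t))) V"
  using assms
proof (induction t arbitrary: x)
  case (Cons r t)
  obtain b r' where br: "row_insert x r = (b, r')" by fastforce
  have r: "sorted r" using Cons.prems by simp
  show ?case
  proof (cases b)
    case None
    then show ?thesis using br row_insert_None[OF r br[unfolded None]] by simp
  next
    case (Some y)
    let ?V = "chain_steps p (concat (rev t)) V"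
    have "chain_steps p (concat (rev (r # t)) @ [x]) V = chain_steps p (r @ [x]) ?V" by simp
    also have "\<dots> = chain_steps p (y # r') ?V"
      by (rule chain_steps_row_insert[OF r br[unfolded Some] chain_mono_steps[OF Cons.prems(2)]])
    also have "\<dots> = chain_steps p r' (chain_steps p (concat (rev t) @ [y]) V)" by simp
    also have "chain_steps p (concat (rev t) @ [y]) V = chain_steps p (concat (rev (tableau_insert y t))) V"
      using Cons by simp
    finally show ?thesis using br Some by simp
  qed
qed simp

lemma chain_count_reading_word:
  "chain_count p w = chain_steps p (concat (rev (rsk_tableau w))) (\<lambda>_. 0)"
proof (induction w rule: rev_induct)
  case (snoc x w)
  have "chain_count p (w @ [x]) = chain_steps p (concat (rev (rsk_tableau w)) @ [x]) (\<lambda>_. 0)"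
    using snoc by (simp add: chain_count_def)
  then show ?case
    unfolding rsk_tableau_snoc
    by (subst (asm) chain_steps_tableau_insert) (auto simp: sorted_rsk_tableau chain_mono_def)
qed (simp add: chain_count_def rsk_tableau_def)

section \<open>The last row of the tableau as a number of chains\<close>

lemma chain_steps_replicate:
  assumes "x < p \<Longrightarrow> V x \<le> V (Suc x)"
  shows "chain_steps p (replicate c x) V x = (if x < p then min (V x + c) (V (Suc x)) else V x + c)"
  using assms
proof (induction c arbitrary: V)
  case (Suc c)
  define W where "W = chain_step p x V"
  have W: "W (Suc x) = V (Suc x)" "W x = (if x < p then min (Suc (V x)) (V (Suc x)) else Suc (V x))"
    by (auto simp: W_def chain_step_def)
  have "chain_steps p (replicate (Suc c) x) V x = chain_steps p (replicate c x) W x"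
    by (simp only: W_def replicate_Suc fold_simps)
  also have "\<dots> = (if x < p then min (W x + c) (W (Suc x)) else W x + c)"
    by (rule Suc.IH) (auto simp: W)
  finally show ?case using Suc.prems by (auto simp: W)
qed (auto simp: min_def)

lemma sorted_eq_replicate_append:
  assumes "sorted r" "\<And>u. u \<in> set r \<Longrightarrow> x \<le> u"
  shows "\<exists>s. r = replicate (length (filter (\<lambda>u. u \<le> x) r)) x @ s \<and> x \<notin> set s"
  using assms
proof (induction r)
  case (Cons h ys)
  then obtain s where s: "ys = replicate (length (filter (\<lambda>u. u \<le> x) ys)) x @ s" "x \<notin> set s"
    by auto
  show ?case
  proof (cases "h = x")
    case True
    then show ?thesis using s by auto
  next
    case False
    then have "\<And>u. u \<in> set (h # ys) \<Longrightarrow> x < u" using Cons.prems by fastforce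
    then have "filter (\<lambda>u. u \<le> x) (h # ys) = []" "x \<notin> set (h # ys)"
      unfolding filter_empty_conv by force+
    then show ?thesis by simp
  qed
qed auto

text \<open>The inequality is interlacing along the diagonal. \<open>g (Suc z) z\<close> counts the
  letters \<open>Suc z\<close> in row \<open>z\<close>, for which this is the smallest possible
  letter.\<close>

lemma gt_patterns_diagonal:
  assumes "g \<in> gt_patterns p \<nu>" "z \<le> z'" "z' < p"
  shows "g (Suc z') z' \<le> g (Suc z) z"
  using assms(2,3)
proof (induction z' rule: dec_induct)
  case (step z')
  then have "g (Suc (Suc z')) (Suc z') \<le> g (Suc z') z'"
    using assms(1) by (auto simp: gt_patterns_def interlaces_def)
  then show ?case using step by simp
qed simp

text \<open>Follow the reading word from the bottom row upwards. Row \<open>i\<close> has only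
  letters above \<open>i\<close> and begins with at least \<open>m\<close> copies of
  \<open>Suc i\<close>. Entry \<open>Suc i\<close> starts from 0 and is stopped at \<open>m\<close>
  by entry \<open>Suc (Suc i)\<close>. The remaining letters of the row are larger and can only
  raise entries that are already at least \<open>m\<close>.\<close>

lemma chain_count_eq_word_pattern:
  assumes w: "w \<in> words n p" and "p \<ge> 1"
  shows "chain_count p w 1 = word_pattern w p (p - 1)"
proof -
  define t where "t = rsk_tableau w"
  define g where "g = word_pattern w"
  define m where "m = g p (p - 1)"
  define V where "V i = chain_steps p (concat (rev (drop i t))) (\<lambda>_. 0)" for i
  have g: "g \<in> gt_patterns p (g p)"
    using word_pattern_in_gt_patterns[OF w] by (simp add: g_def)
  have row: "g z i = length (filter (\<lambda>u. u \<le> z) (t ! i))" if "i < length t" for z i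
    using that by (simp add: g_def word_pattern_def tableau_pattern_def t_def)
  have norow: "g z i = 0" if "i \<ge> length t" for z i
    using that by (simp add: g_def word_pattern_def tableau_pattern_def t_def)
  have le_p: "u \<le> p" if "i < length t" "u \<in> set (t ! i)" for i u
  proof -
    have "u \<in> \<Union>(set ` set t)" using that by auto
    then have "u \<in> set w" using entries_rsk_tableau[of w] unfolding t_def by blast
    then show ?thesis using w by (auto simp: words_def)
  qed
  have mono: "chain_mono p (V i)" for i
    unfolding V_def by (rule chain_mono_steps) (simp add: chain_mono_def)
  have "(\<forall>y\<le>i. V i y = 0) \<and> (i < p \<longrightarrow> V i (Suc i) = m) \<and> (\<forall>y. i < y \<and> y \<le> p \<longrightarrow> m \<le> V i y)"
    if "i \<le> p" for i
    using that
  proof (induction i rule: inc_induct)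
    case base
    have "r = []" if r: "r \<in> set (drop p t)" for r
    proof -
      obtain k where "k < length t - p" "r = t ! (p + k)"
        using r by (auto simp: in_set_conv_nth)
      then obtain i where i: "i \<ge> p" "i < length t" "r = t ! i"
        by (metis le_add1 less_diff_conv add.commute)
      have "g p i = 0" by (rule gt_patterns_support[OF g]) (use i in auto)
      then have "filter (\<lambda>u. u \<le> p) r = []" using row[OF i(2)] i(3) by simp
      then show ?thesis using le_p[OF i(2)] i(3) by (cases r) auto
    qed
    then have "concat (rev (drop p t)) = []" by simp
    then have "V p = (\<lambda>_. 0)" unfolding V_def by (simp only: fold_simps id_apply)
    then show ?case by simp
  next
    case (step i)
    note IH = step.IH
    show ?case
    proof (cases "i < length t")
      case False
      then have eq: "V i = V (Suc i)" by (simp add: V_def)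
      have "m = 0"
        using gt_patterns_diagonal[OF g, of i "p - 1"] norow[of i "Suc i"] False step.hyps
        by (simp add: m_def)
      then show ?thesis using IH step.hyps by (auto simp: eq le_Suc_eq)
    next
      case True
      let ?r = "t ! i" and ?x = "Suc i"
      have "drop i t = ?r # drop ?x t" using True by (simp add: Cons_nth_drop_Suc)
      then have Vi: "V i = chain_steps p ?r (V ?x)" by (simp add: V_def)
      have ge: "?x \<le> u" if "u \<in> set ?r" for u
      proof (rule ccontr)
        assume "\<not> ?x \<le> u"
        then have "filter (\<lambda>u. u \<le> i) ?r \<noteq> []" using that by (auto simp: filter_empty_conv intro!: bexI[of _ u])
        moreover have "g i i = 0" by (rule gt_patterns_support[OF g]) (use step.hyps in auto)
        ultimately show False using row[OF True, of i] by simp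
      qed
      define c where "c = g ?x i"
      have "sorted ?r" using True sorted_rsk_tableau[of w] by (simp add: t_def)
      then obtain s where s: "?r = replicate c ?x @ s" "?x \<notin> set s"
        using sorted_eq_replicate_append[OF _ ge] row[OF True, of ?x] unfolding c_def by metis
      have "m \<le> c"
        using gt_patterns_diagonal[OF g, of i "p - 1"] step.hyps by (simp add: m_def c_def)
      have "V i ?x = chain_steps p (replicate c ?x) (V ?x) ?x"
        unfolding Vi s(1) using s(2) by (simp add: chain_steps_other)
      also have "\<dots> = (if ?x < p then min (V ?x ?x + c) (V ?x (Suc ?x)) else V ?x ?x + c)"
        using mono[of ?x] by (intro chain_steps_replicate) (auto simp: chain_mono_def)
      also have "\<dots> = m"
      proof (cases "?x < p")
        \<comment> \<open>For the letter \<open>p\<close> there is no entry above that limits the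
          growth, but row \<open>p - 1\<close> contains it exactly \<open>m\<close> times.\<close>
        case False
        then have "p = Suc i" using step.hyps by simp
        then show ?thesis using IH by (simp add: c_def m_def)
      qed (use IH \<open>m \<le> c\<close> in simp)
      finally have *: "V i ?x = m" .
      moreover have "V i y = 0" if "y \<le> i" for y
        using IH ge that unfolding Vi by (subst chain_steps_other) force+
      moreover have "m \<le> V i y" if "i < y" "y \<le> p" for y
      proof (cases "y = ?x")
        case False
        then have "m \<le> V ?x y" using IH that by auto
        also have "\<dots> \<le> V i y" unfolding Vi by (rule chain_steps_ge[OF mono])
        finally show ?thesis .
      qed (use * in simp)
      ultimately show ?thesis by blast
    qed
  qed
  from this[of 0] show ?thesis
    using assms(2) by (simp add: V_def chain_count_reading_word t_def m_def g_def)
qed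

section \<open>Duality between decreasing chains and unions of increasing subsequences\<close>

lemma sorted_wrt_nths_iff:
  "sorted_wrt P (nths w A) \<longleftrightarrow>
    (\<forall>i\<in>A. \<forall>j\<in>A. i < j \<and> j < length w \<longrightarrow> P (w ! i) (w ! j))"
proof (induction w rule: rev_induct)
  case (snoc x w)
  have "sorted_wrt P (nths (w @ [x]) A) \<longleftrightarrow>
      sorted_wrt P (nths w A) \<and> (length w \<in> A \<longrightarrow> (\<forall>i\<in>A. i < length w \<longrightarrow> P (w ! i) x))"
    by (auto simp: nths_append sorted_wrt_append set_nths)
  then show ?case
    unfolding snoc.IH by (auto simp: nth_append less_Suc_eq)
qed simp

lemma length_nths_eq_card: "I \<subseteq> {..<length w} \<Longrightarrow> length (nths w I) = card I"
  unfolding length_nths by (rule arg_cong[of _ _ card]) auto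

lemma chain_count_snoc: "chain_count p (w @ [x]) = chain_step p x (chain_count p w)"
  by (simp add: chain_count_def)

lemma incr_len_set_finite:
  "finite {card I | I. I \<subseteq> {..<length w} \<and>
     (\<exists>J. I = (\<Union>j<k. J j) \<and> disjoint_family_on J {..<k} \<and> (\<forall>j<k. sorted (nths w (J j))))}"
  by (rule finite_subset[of _ "card ` Pow {..<length w}"]) auto

lemma decr_len_set_finite:
  "finite {card I | I. I \<subseteq> {..<length w} \<and> sorted_wrt (>) (nths w I)}"
  by (rule finite_subset[of _ "card ` Pow {..<length w}"]) auto

text \<open>Deleting a minimum set of letters that meets all chains \<open>p > \<dots> > y\<close> leaves
  a word in which the \<open>c\<close>-th subsequence first consists of letters \<open>c + 1\<close> and then
  possibly of letters \<open>c + 2\<close>; the deleted letters decrease from \<open>p\<close> to \<open>y\<close>.\<close>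

lemma exists_increasing_cover:
  assumes "set w \<subseteq> {1..p}" "1 \<le> y" "y \<le> p"
  shows "\<exists>J. disjoint_family_on J {..<p - 1} \<and>
    (\<forall>c<p - 1. J c \<subseteq> {..<length w} \<and> sorted (nths w (J c)) \<and>
       (\<forall>q\<in>J c. w ! q = Suc c \<or> w ! q = Suc (Suc c) \<and> y \<le> Suc c)) \<and>
    length w \<le> card (\<Union>c<p - 1. J c) + chain_count p w y"
  using assms
proof (induction w arbitrary: y rule: rev_induct)
  case Nil
  show ?case by (rule exI[of _ "\<lambda>_. {}"]) (simp add: disjoint_family_on_def)
next
  case (snoc x w)
  let ?n = "length w" and ?V = "chain_count p w"
  define good where "good w y J m \<longleftrightarrow> disjoint_family_on J {..<p - 1} \<and>
    (\<forall>c<p - 1. J c \<subseteq> {..<length w} \<and> sorted (nths w (J c)) \<and>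
       (\<forall>q\<in>J c. w ! q = Suc c \<or> w ! q = Suc (Suc c) \<and> y \<le> Suc c)) \<and>
    length w \<le> card (\<Union>c<p - 1. J c) + m" for w y J m
  have IH: "\<exists>J. good w y J (?V y)" if "1 \<le> y" "y \<le> p" for y
    using snoc.IH[of y] snoc.prems(1) that unfolding good_def by simp
  have skip: "good (w @ [x]) y J (Suc m)" if "good w y J m" for y J m
  proof -
    have "nths (w @ [x]) (J c) = nths w (J c)" if "c < p - 1" for c
      using \<open>good w y J m\<close> that by (auto simp: good_def nths_append)
    then show ?thesis
      using that by (fastforce simp: good_def nth_append)
  qed
  have extend: "\<exists>J. good (w @ [x]) y J m"
    if J: "good w y' J m" "y \<le> y'" and c: "c < p - 1" "x = Suc c \<or> x = Suc (Suc c) \<and> y \<le> Suc c"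
      "\<And>q. q \<in> J c \<Longrightarrow> w ! q \<le> x" for y y' J m c
  proof -
    let ?J = "J(c := insert ?n (J c))"
    have sub: "J d \<subseteq> {..<?n}" if "d < p - 1" for d using J that by (auto simp: good_def)
    have "good (w @ [x]) y ?J m"
      unfolding good_def
    proof (intro conjI allI impI)
      show "disjoint_family_on ?J {..<p - 1}"
        unfolding disjoint_family_on_def
      proof (intro ballI impI)
        fix a b assume ab: "a \<in> {..<p - 1}" "b \<in> {..<p - 1}" "a \<noteq> b"
        have "J a \<inter> J b = {}" using J(1) ab by (simp add: good_def disjoint_family_on_def)
        moreover have "?n \<notin> J a" "?n \<notin> J b" using sub ab by auto
        ultimately show "?J a \<inter> ?J b = {}" using ab(3) by auto
      qed
      fix d assume d: "d < p - 1"
      show "?J d \<subseteq> {..<length (w @ [x])}" using sub[OF d] by auto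
      have "nths w (insert ?n (J c)) = nths w (J c)"
        by (auto simp: nths_def intro!: filter_cong arg_cong[of _ _ "map fst"] dest: set_zip_rightD)
      then have "nths (w @ [x]) (?J d) = (if d = c then nths w (J c) @ [x] else nths w (J d))"
        using sub[OF d] by (auto simp: nths_append)
      moreover have "\<forall>u\<in>set (nths w (J c)). u \<le> x" using c(3) by (auto simp: set_nths)
      ultimately show "sorted (nths (w @ [x]) (?J d))"
        using J(1) d c(1) by (auto simp: good_def sorted_append)
      show "\<forall>q\<in>?J d. (w @ [x]) ! q = Suc d \<or> (w @ [x]) ! q = Suc (Suc d) \<and> y \<le> Suc d"
      proof
        fix q assume q: "q \<in> ?J d"
        show "(w @ [x]) ! q = Suc d \<or> (w @ [x]) ! q = Suc (Suc d) \<and> y \<le> Suc d"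
        proof (cases "q = ?n")
          case True
          then have "d = c" using q sub[OF d] by (auto split: if_splits)
          then show ?thesis using True c(2) by simp
        next
          case False
          then have "q \<in> J d" using q by (auto split: if_splits)
          moreover have "q < ?n" using calculation sub[OF d] by auto
          ultimately show ?thesis using J d by (fastforce simp: good_def nth_append)
        qed
      qed
    next
      have "(\<Union>d<p - 1. ?J d) = insert ?n (\<Union>d<p - 1. J d)" using c(1) by auto
      moreover have "(\<Union>d<p - 1. J d) \<subseteq> {..<?n}" using sub by auto
      then have "finite (\<Union>d<p - 1. J d)" "?n \<notin> (\<Union>d<p - 1. J d)" by (auto intro: finite_subset)
      ultimately show "length (w @ [x]) \<le> card (\<Union>d<p - 1. ?J d) + m"
        using J(1) by (simp add: good_def)
    qed
    then show ?thesis by blast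
  qed
  have x: "1 \<le> x" "x \<le> p" using snoc.prems(1) by auto
  have "\<exists>J. good (w @ [x]) y J (chain_step p x ?V y)"
  proof (cases "y = x")
    case False
    then have eq: "chain_step p x ?V y = ?V y" by (simp add: chain_step_def)
    obtain J where J: "good w y J (?V y)" using IH snoc.prems by blast
    \<comment> \<open>For \<open>x < y\<close> the letter joins subsequence \<open>x - 1\<close>,
      which so far has no letter but \<open>x\<close>; for \<open>x > y\<close> it joins subsequence
      \<open>x - 2\<close> as the larger of its two values. Either way no earlier letter there is
      larger.\<close>
    define c where "c = (if x < y then x - 1 else x - 2)"
    have c: "c < p - 1" using False x snoc.prems(2,3) by (auto simp: c_def)
    have "w ! q \<le> x" if "q \<in> J c" for q
    proof -
      have "w ! q = Suc c \<or> w ! q = Suc (Suc c) \<and> y \<le> Suc c"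
        using J c that by (auto simp: good_def)
      then show ?thesis using False x snoc.prems(2) by (auto simp: c_def split: if_splits)
    qed
    moreover have "x = Suc c \<or> x = Suc (Suc c) \<and> y \<le> Suc c"
      using False x snoc.prems(2) by (auto simp: c_def)
    ultimately show ?thesis unfolding eq by (intro extend[OF J order.refl c]) auto
  next
    case True
    show ?thesis
    proof (cases "x < p \<and> ?V (Suc x) \<le> Suc (?V x)")
      case sat: True
      then have eq: "chain_step p x ?V y = ?V (Suc x)" using True by (simp add: chain_step_def)
      \<comment> \<open>Entry \<open>x\<close> is limited by entry \<open>Suc x\<close>, so the
        deletions chosen for \<open>Suc x\<close> are already cheap enough. They leave only letters
        \<open>x\<close> in subsequence \<open>x - 1\<close>, which can take the new one.\<close>
      obtain J where J: "good w (Suc x) J (?V (Suc x))" using IH[of "Suc x"] sat by auto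
      have c: "x - 1 < p - 1" "Suc (x - 1) = x" using sat x by auto
      have "w ! q \<le> x" if "q \<in> J (x - 1)" for q
        using J c that by (auto simp: good_def)
      then show ?thesis unfolding eq
        using c True by (intro extend[OF J _ c(1)]) auto
    next
      case False
      then have eq: "chain_step p x ?V y = Suc (?V y)"
        using True by (auto simp: chain_step_def min_def)
      show ?thesis unfolding eq using IH[OF snoc.prems(2,3)] skip by blast
    qed
  qed
  then show ?case unfolding chain_count_snoc good_def .
qed

text \<open>\<open>pos y c\<close> is the position of the letter \<open>y\<close> in chain
  \<open>c\<close>. The chains are numbered so that those reaching \<open>y\<close> are the first
  ones among those reaching \<open>Suc y\<close>; a new letter \<open>x\<close> then prolongs the
  chain whose number is the current entry \<open>x\<close>. Injectivity of \<open>pos y\<close>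
  makes the chains disjoint.\<close>

lemma exists_chains:
  assumes "set w \<subseteq> {1..p}"
  shows "\<exists>pos. \<forall>y\<in>{1..p}. inj_on (pos y) {..<chain_count p w y} \<and>
    (\<forall>c<chain_count p w y. pos y c < length w \<and> w ! pos y c = y \<and> (y < p \<longrightarrow> pos (Suc y) c < pos y c))"
  using assms
proof (induction w rule: rev_induct)
  case Nil
  then show ?case by (simp add: chain_count_def)
next
  case (snoc x w)
  let ?V = "chain_count p w"
  from snoc.prems have "set w \<subseteq> {1..p}" by simp
  from snoc.IH[OF this] obtain pos where "\<forall>y\<in>{1..p}. inj_on (pos y) {..<?V y} \<and>
    (\<forall>c<?V y. pos y c < length w \<and> w ! pos y c = y \<and> (y < p \<longrightarrow> pos (Suc y) c < pos y c))" ..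
  then have pos: "\<And>y. y \<in> {1..p} \<Longrightarrow> inj_on (pos y) {..<?V y}"
    "\<And>y c. y \<in> {1..p} \<Longrightarrow> c < ?V y \<Longrightarrow>
       pos y c < length w \<and> w ! pos y c = y \<and> (y < p \<longrightarrow> pos (Suc y) c < pos y c)"
    by blast+
  have x: "1 \<le> x" "x \<le> p" using snoc.prems by auto
  show ?case
  proof (cases "x < p \<and> ?V (Suc x) \<le> ?V x")
    case True
    then have "?V x = ?V (Suc x)" using chain_mono_count[of p w] by (auto simp: chain_mono_def intro: le_antisym)
    then have eq: "chain_count p (w @ [x]) = ?V"
      using True by (auto simp: chain_count_snoc chain_step_def)
    show ?thesis unfolding eq
      using pos by (intro exI[of _ pos] ballI conjI allI impI) (auto simp: nth_append less_SucI)
  next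
    case False
    then have eq: "chain_count p (w @ [x]) = ?V(x := Suc (?V x))"
      by (auto simp: chain_count_snoc chain_step_def)
    let ?pos = "pos(x := (pos x)(?V x := length w))"
    have "inj_on (?pos y) {..<(?V(x := Suc (?V x))) y}" if y: "y \<in> {1..p}" for y
    proof (cases "y = x")
      case True
      have "pos x c \<noteq> length w" if "c < ?V x" for c using pos(2)[of x c] that x by auto
      then have "length w \<notin> pos x ` {..<?V x}" by force
      moreover from this have "inj_on ((pos x)(?V x := length w)) {..<?V x}"
        using pos(1)[OF y] True by (intro inj_on_fun_updI) auto
      ultimately show ?thesis
        using True by (auto simp: lessThan_Suc inj_on_insert)
    qed (use pos(1)[OF y] in simp)
    moreover have "?pos y c < length (w @ [x]) \<and> (w @ [x]) ! ?pos y c = y \<and> (y < p \<longrightarrow> ?pos (Suc y) c < ?pos y c)"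
      if y: "y \<in> {1..p}" and c: "c < (?V(x := Suc (?V x))) y" for y c
    proof (cases "y = x \<and> c = ?V x")
      case True
      have "pos (Suc x) (?V x) < length w" if "x < p"
        using pos(2)[of "Suc x" "?V x"] False that x by auto
      then show ?thesis using True by auto
    next
      case other: False
      then have c': "c < ?V y" using c by (auto split: if_splits)
      have "c < ?V (Suc y)" if "y < p"
        using that c' chain_mono_count[of p w] by (auto simp: chain_mono_def intro: less_le_trans)
      then have "?pos (Suc y) c = pos (Suc y) c" if "y < p" using that by auto
      then show ?thesis
        using pos(2)[OF y c'] other by (auto simp: nth_append)
    qed
    ultimately show ?thesis unfolding eq by (intro exI[of _ ?pos]) blast
  qed
qed

lemma exists_full_chains:
  assumes "set w \<subseteq> {1..p}"
  shows "\<exists>pos. (\<forall>y\<in>{1..p}. inj_on (pos y) {..<chain_count p w 1} \<and>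
      (\<forall>c<chain_count p w 1. pos y c < length w \<and> w ! pos y c = y)) \<and>
    (\<forall>c<chain_count p w 1. \<forall>y z. 1 \<le> y \<longrightarrow> y < z \<longrightarrow> z \<le> p \<longrightarrow> pos z c < pos y c)"
proof -
  from exists_chains[OF assms] obtain pos where "\<forall>y\<in>{1..p}. inj_on (pos y) {..<chain_count p w y} \<and>
    (\<forall>c<chain_count p w y. pos y c < length w \<and> w ! pos y c = y \<and> (y < p \<longrightarrow> pos (Suc y) c < pos y c))" ..
  then have pos: "\<And>y. y \<in> {1..p} \<Longrightarrow> inj_on (pos y) {..<chain_count p w y}"
    "\<And>y c. y \<in> {1..p} \<Longrightarrow> c < chain_count p w y \<Longrightarrow>
       pos y c < length w \<and> w ! pos y c = y \<and> (y < p \<longrightarrow> pos (Suc y) c < pos y c)"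
    by blast+
  have count_mono: "chain_count p w 1 \<le> chain_count p w y" if "1 \<le> y" "y \<le> p" for y
    using that
  proof (induction y rule: dec_induct)
    case (step y)
    then have "chain_count p w y \<le> chain_count p w (Suc y)"
      using chain_mono_count[of p w] by (auto simp: chain_mono_def)
    then show ?case using step by simp
  qed simp
  have next_pos: "pos (Suc y) c < pos y c" if "1 \<le> y" "y < p" "c < chain_count p w 1" for y c
    using pos(2)[of y c] count_mono[of y] that by auto
  have chain: "pos z c < pos y c" if "1 \<le> y" "y < z" "z \<le> p" "c < chain_count p w 1" for y z c
    using Suc_leI[OF that(2)] that(3)
  proof (induction z rule: dec_induct)
    case base
    then show ?case using next_pos that by simp
  next
    case (step z)
    then have "pos (Suc z) c < pos z c" using next_pos[of z c] that by simp
    then show ?case using step by simp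
  qed
  have "inj_on (pos y) {..<chain_count p w 1} \<and>
      (\<forall>c<chain_count p w 1. pos y c < length w \<and> w ! pos y c = y)" if "y \<in> {1..p}" for y
    using pos(1)[OF that] pos(2)[OF that] count_mono[of y] that
    by (auto intro: inj_on_subset)
  then show ?thesis using chain by blast
qed

text \<open>A union of \<open>p - 1\<close> increasing subsequences misses a letter of every full
  chain, since otherwise two of its \<open>p\<close> decreasing letters would share a subsequence.
  The chains are disjoint, so the missed positions are distinct. The cover from
  \<open>exists_increasing_cover\<close> with \<open>y = 1\<close> attains this bound.\<close>

lemma incr_len_plus_chain_count:
  assumes w: "w \<in> words n p" and "p \<ge> 1"
  shows "incr_len (p - 1) w + chain_count p w 1 = n"
proof -
  let ?S = "{card I | I. I \<subseteq> {..<length w} \<and>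
     (\<exists>J. I = (\<Union>j<p - 1. J j) \<and> disjoint_family_on J {..<p - 1} \<and> (\<forall>j<p - 1. sorted (nths w (J j))))}"
  have n: "length w = n" and set: "set w \<subseteq> {1..p}" using w by (auto simp: words_def)
  obtain J where J: "disjoint_family_on J {..<p - 1}"
     "\<forall>c<p - 1. J c \<subseteq> {..<length w} \<and> sorted (nths w (J c))"
     "n \<le> card (\<Union>c<p - 1. J c) + chain_count p w 1"
    using exists_increasing_cover[OF set, of 1] assms(2) n by blast
  have "card (\<Union>c<p - 1. J c) \<in> ?S"
    using J(1,2) by (intro CollectI exI[of _ "\<Union>c<p - 1. J c"] exI[of _ J] conjI refl) auto
  then have ge: "card (\<Union>c<p - 1. J c) \<le> incr_len (p - 1) w"
    unfolding incr_len_def by (rule Max_ge[OF incr_len_set_finite])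
  obtain pos where pos: "\<And>y. y \<in> {1..p} \<Longrightarrow> inj_on (pos y) {..<chain_count p w 1}"
    "\<And>y c. y \<in> {1..p} \<Longrightarrow> c < chain_count p w 1 \<Longrightarrow> pos y c < length w \<and> w ! pos y c = y"
    and chain: "\<And>y z c. c < chain_count p w 1 \<Longrightarrow> 1 \<le> y \<Longrightarrow> y < z \<Longrightarrow> z \<le> p \<Longrightarrow> pos z c < pos y c"
    using exists_full_chains[OF set] by metis
  have le: "card I + chain_count p w 1 \<le> n"
    if I: "I \<subseteq> {..<length w}" "I = (\<Union>j<p - 1. K j)" "\<forall>j<p - 1. sorted (nths w (K j))" for I K
  proof -
    have "\<exists>y\<in>{1..p}. pos y c \<notin> I" if c: "c < chain_count p w 1" for c
    proof (rule ccontr)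
      assume "\<not> (\<exists>y\<in>{1..p}. pos y c \<notin> I)"
      then have "\<forall>y\<in>{1..p}. \<exists>j<p - 1. pos y c \<in> K j" using I(2) by auto
      then obtain f where f: "\<And>y. y \<in> {1..p} \<Longrightarrow> f y < p - 1 \<and> pos y c \<in> K (f y)" by metis
      have "\<not> inj_on f {1..p}"
      proof
        assume "inj_on f {1..p}"
        then have "card {1..p} \<le> card {..<p - 1}" using f by (intro card_inj_on_le) auto
        then show False using assms(2) by simp
      qed
      then obtain y z where yz: "y \<in> {1..p}" "z \<in> {1..p}" "y < z" "f y = f z"
        unfolding inj_on_def by (metis linorder_neqE_nat)
      have "pos z c < pos y c" using chain yz c by auto
      moreover have "pos y c < length w" "w ! pos y c = y" "w ! pos z c = z"
        using pos(2) yz(1,2) c by auto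
      moreover have "sorted (nths w (K (f y)))" using I(3) f[OF yz(1)] by blast
      ultimately have "z \<le> y"
        using f[OF yz(1)] f[OF yz(2)] yz(4) unfolding sorted_wrt_nths_iff by metis
      then show False using yz(3) by simp
    qed
    then obtain m where m: "\<And>c. c < chain_count p w 1 \<Longrightarrow> m c \<in> {1..p} \<and> pos (m c) c \<notin> I" by metis
    have pos': "pos (m c) c < length w" "w ! pos (m c) c = m c" if "c < chain_count p w 1" for c
      using pos(2)[of "m c" c] m[OF that] that by auto
    have "inj_on (\<lambda>c. pos (m c) c) {..<chain_count p w 1}"
    proof (rule inj_onI)
      fix c d assume cd: "c \<in> {..<chain_count p w 1}" "d \<in> {..<chain_count p w 1}" "pos (m c) c = pos (m d) d"
      then have "m c = m d" using pos'(2)[of c] pos'(2)[of d] by auto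
      then show "c = d"
        using cd pos(1)[of "m c"] m[of c] by (auto dest: inj_onD)
    qed
    moreover have "(\<lambda>c. pos (m c) c) ` {..<chain_count p w 1} \<subseteq> {..<n} - I"
      using m pos'(1) n by auto
    ultimately have "card {..<chain_count p w 1} \<le> card ({..<n} - I)"
      by (intro card_inj_on_le) auto
    also have "\<dots> = n - card I" using I(1) n by (subst card_Diff_subset) (auto intro: finite_subset)
    finally have "chain_count p w 1 \<le> n - card I" by simp
    moreover have "card I \<le> n" using I(1) n card_mono[of "{..<n}" I] by auto
    ultimately show ?thesis by simp
  qed
  have "?S \<noteq> {}" using \<open>card (\<Union>c<p - 1. J c) \<in> ?S\<close> by blast
  then have "incr_len (p - 1) w \<in> ?S"
    unfolding incr_len_def by (rule Max_in[OF incr_len_set_finite])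
  then have "incr_len (p - 1) w + chain_count p w 1 \<le> n" using le by auto
  then show ?thesis using ge J(3) by simp
qed

text \<open>One full chain has \<open>p\<close> letters, and a strictly decreasing subsequence
  cannot repeat any of the letters from 1 to \<open>p\<close>.\<close>

lemma decr_len_eq:
  assumes w: "w \<in> words n p" and "p \<ge> 1" "chain_count p w 1 \<ge> 1"
  shows "decr_len w = p"
proof -
  let ?S = "{card I | I. I \<subseteq> {..<length w} \<and> sorted_wrt (>) (nths w I)}"
  have set: "set w \<subseteq> {1..p}" using w by (auto simp: words_def)
  obtain pos where pos: "\<And>y. y \<in> {1..p} \<Longrightarrow> pos y 0 < length w \<and> w ! pos y 0 = y"
    and chain: "\<And>y z. 1 \<le> y \<Longrightarrow> y < z \<Longrightarrow> z \<le> p \<Longrightarrow> pos z 0 < pos y (0::nat)"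
  proof -
    have "0 < chain_count p w 1" using assms(3) by simp
    then show thesis using exists_full_chains[OF set] that by blast
  qed
  let ?I = "(\<lambda>y. pos y 0) ` {1..p}"
  have "inj_on (\<lambda>y. pos y 0) {1..p}" by (rule inj_on_inverseI[of _ "nth w"]) (use pos in blast)
  then have card: "card ?I = p" by (simp add: card_image)
  have "sorted_wrt (>) (nths w ?I)"
    unfolding sorted_wrt_nths_iff
  proof (intro ballI impI)
    fix i j assume "i \<in> ?I" "j \<in> ?I" and ij: "i < j \<and> j < length w"
    then obtain y z where yz: "y \<in> {1..p}" "z \<in> {1..p}" "i = pos y 0" "j = pos z 0" by auto
    then have "\<not> y \<le> z" using chain[of y z] ij by (auto simp: le_less)
    then show "w ! i > w ! j" using pos yz by simp
  qed
  then have "p \<in> ?S"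
    using card pos by (intro CollectI exI[of _ ?I]) auto
  moreover have "m \<le> p" if m: "m \<in> ?S" for m
  proof -
    obtain I where I: "m = card I" "I \<subseteq> {..<length w}" "sorted_wrt (>) (nths w I)"
      using m by blast
    then have "sorted_wrt (<) (rev (nths w I))" by (simp add: sorted_wrt_rev)
    then have "distinct (nths w I)" unfolding strict_sorted_iff by simp
    then have "m = card (set (nths w I))"
      using I length_nths_eq_card[OF I(2)] by (simp add: distinct_card)
    also have "\<dots> \<le> card {1..p}"
      using set notin_set_nthsI by (intro card_mono) (auto dest: in_set_nthsD)
    finally show ?thesis by simp
  qed
  ultimately show ?thesis
    unfolding decr_len_def by (intro Max_eqI decr_len_set_finite) auto
qed

section \<open>Moments of the chi-square distribution and Stirling's formula\<close>

lemma pochhammer_half_nonneg: "0 \<le> pochhammer (real m / 2) k"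
  by (simp add: pochhammer_prod prod_nonneg)

lemma nn_integral_std_normal_even:
  "(\<integral>\<^sup>+y. ennreal (y ^ (2 * r)) \<partial>density lborel std_normal_density) = ennreal (2 ^ r * pochhammer (1/2) r)"
proof -
  have "(\<integral>\<^sup>+y. ennreal (y ^ (2 * r)) \<partial>density lborel std_normal_density) =
      (\<integral>\<^sup>+y. ennreal (std_normal_density y * y ^ (2 * r)) \<partial>lborel)"
    by (subst nn_integral_density) (auto simp: ennreal_mult')
  also have "\<dots> = ennreal (fact (2 * r) / (2 ^ r * fact r))"
    using std_normal_moment_even[of r]
    by (intro nn_integral_eq_integral[THEN trans]) (auto simp: has_bochner_integral_iff power_mult)
  also have "(fact (2 * r) / (2 ^ r * fact r) :: real) = 2 ^ r * pochhammer (1/2) r"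
  proof -
    have "(4::real) ^ r = 2 ^ r * 2 ^ r" by (simp flip: power_mult_distrib)
    then show ?thesis by (simp add: fact_double power_mult)
  qed
  finally show ?thesis .
qed

text \<open>The binomial theorem splits off the square of one coordinate, whose moments are
  \<open>2 ^ r * pochhammer (1/2) r\<close>. The Chu-Vandermonde identity for rising factorials then
  adds the parameters \<open>m / 2\<close> and 1/2. With nonnegative integrals the iterated
  integration needs no integrability argument.\<close>

lemma nn_integral_sum_squares:
  "(\<integral>\<^sup>+x. ennreal ((\<Sum>i<m. (x i)\<^sup>2) ^ k) \<partial>Pi\<^sub>M {..<m} (\<lambda>_. density lborel std_normal_density)) =
     ennreal (2 ^ k * pochhammer (real m / 2) k)"
proof (induction m arbitrary: k)
  case 0
  show ?case by (cases k) (auto simp: PiM_empty nn_integral_count_space_finite pochhammer_0_left)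
next
  case (Suc m)
  let ?N = "density lborel std_normal_density"
  let ?S = "\<lambda>x. \<Sum>i<m. (x i)\<^sup>2 :: real"
  let ?c = "\<lambda>j. real (k choose j) * (2 ^ (k - j) * pochhammer (1/2) (k - j))"
  interpret prob_space ?N by (rule prob_space_normal_density) simp
  interpret product_sigma_finite "\<lambda>_::nat. ?N" ..
  have inner: "(\<integral>\<^sup>+y. ennreal ((\<Sum>i<Suc m. ((x(m := y)) i)\<^sup>2) ^ k) \<partial>?N) =
      (\<Sum>j\<le>k. ennreal (?c j) * ennreal (?S x ^ j))" for x :: "nat \<Rightarrow> real"
  proof -
    have nonneg: "0 \<le> ?S x" by (simp add: sum_nonneg)
    have "(\<Sum>i<Suc m. ((x(m := y)) i)\<^sup>2) ^ k = (\<Sum>j\<le>k. real (k choose j) * ?S x ^ j * y ^ (2 * (k - j)))" for y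
      by (simp add: binomial_ring power_mult)
    then have "(\<integral>\<^sup>+y. ennreal ((\<Sum>i<Suc m. ((x(m := y)) i)\<^sup>2) ^ k) \<partial>?N) =
       (\<integral>\<^sup>+y. (\<Sum>j\<le>k. ennreal (real (k choose j) * ?S x ^ j) * ennreal (y ^ (2 * (k - j)))) \<partial>?N)"
      using nonneg by (simp add: sum_ennreal ennreal_mult[symmetric] power_mult)
    also have "\<dots> = (\<Sum>j\<le>k. ennreal (real (k choose j) * ?S x ^ j) * ennreal (2 ^ (k - j) * pochhammer (1/2) (k - j)))"
      by (subst nn_integral_sum) (auto simp: nn_integral_cmult nn_integral_std_normal_even)
    also have "\<dots> = (\<Sum>j\<le>k. ennreal (?c j) * ennreal (?S x ^ j))"
      using nonneg
      by (intro sum.cong refl) (simp add: ennreal_mult[symmetric] pochhammer_nonneg mult_ac)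
    finally show ?thesis .
  qed
  have "(\<integral>\<^sup>+x. ennreal ((\<Sum>i<Suc m. (x i)\<^sup>2) ^ k) \<partial>Pi\<^sub>M {..<Suc m} (\<lambda>_. ?N)) =
     (\<integral>\<^sup>+x. (\<integral>\<^sup>+y. ennreal ((\<Sum>i<Suc m. ((x(m := y)) i)\<^sup>2) ^ k) \<partial>?N) \<partial>Pi\<^sub>M {..<m} (\<lambda>_. ?N))"
    unfolding lessThan_Suc by (rule product_nn_integral_insert) (auto intro!: measurable_compose[OF measurable_component_singleton])
  also have "\<dots> = (\<integral>\<^sup>+x. (\<Sum>j\<le>k. ennreal (?c j) * ennreal (?S x ^ j)) \<partial>Pi\<^sub>M {..<m} (\<lambda>_. ?N))"
    by (simp only: inner)
  also have "\<dots> = (\<Sum>j\<le>k. ennreal (?c j) * ennreal (2 ^ j * pochhammer (real m / 2) j))"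
    by (subst nn_integral_sum) (auto simp: nn_integral_cmult Suc.IH intro!: sum.cong)
  also have "\<dots> = ennreal (\<Sum>j\<le>k. ?c j * (2 ^ j * pochhammer (real m / 2) j))"
    by (simp add: sum_ennreal ennreal_mult[symmetric] pochhammer_half_nonneg pochhammer_nonneg)
  also have "(\<Sum>j\<le>k. ?c j * (2 ^ j * pochhammer (real m / 2) j)) =
      (\<Sum>j\<le>k. 2 ^ k * (real (k choose j) * pochhammer (real m / 2) j * pochhammer (1/2) (k - j)))"
    by (intro sum.cong refl) (simp add: power_add[symmetric] algebra_simps flip: power_add)
  also have "\<dots> = 2 ^ k * pochhammer (real (Suc m) / 2) k"
    unfolding sum_distrib_left[symmetric] pochhammer_binomial_sum[symmetric] by (simp add: add_divide_distrib add.commute)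
  finally show ?case .
qed

lemma chi_square_moment:
  "(\<integral>z. (z / 2) ^ k \<partial>chi_square m) = pochhammer (real m / 2) k"
proof -
  let ?P = "Pi\<^sub>M {..<m} (\<lambda>_. density lborel std_normal_density)"
  have meas: "(\<lambda>x. \<Sum>i<m. (x i)\<^sup>2) \<in> borel_measurable ?P"
    by (auto intro!: borel_measurable_sum borel_measurable_power measurable_compose[OF measurable_component_singleton])
  have "(\<integral>z. (z / 2) ^ k \<partial>chi_square m) = (\<integral>x. (1/2) ^ k * (\<Sum>i<m. (x i)\<^sup>2) ^ k \<partial>?P)"
    unfolding chi_square_def by (subst integral_distr[OF meas]) (auto simp: power_divide)
  also have "\<dots> = (1/2) ^ k * (\<integral>x. (\<Sum>i<m. (x i)\<^sup>2) ^ k \<partial>?P)" by simp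
  also have "(\<integral>x. (\<Sum>i<m. (x i)\<^sup>2) ^ k \<partial>?P) =
      enn2real (\<integral>\<^sup>+x. ennreal ((\<Sum>i<m. (x i)\<^sup>2) ^ k) \<partial>?P)"
    using meas by (intro integral_eq_nn_integral) (auto simp: sum_nonneg)
  also have "\<dots> = 2 ^ k * pochhammer (real m / 2) k"
    by (subst nn_integral_sum_squares) (simp add: pochhammer_half_nonneg)
  finally show ?thesis by (simp add: power_divide)
qed

text \<open>For q = p^2 this matches the chi-square moment with the sum of squares; its
  \<open>fact k\<close> cancels the one in the denominator of the limit.\<close>

lemma pochhammer_of_nat_eq:
  assumes "q \<ge> 1"
  shows "pochhammer (real q) k = fact k * real (q - 1 + k choose k)"
proof -
  have "real (q - 1 + k choose k) = (real (q - 1 + k)) gchoose k" by (simp add: binomial_gbinomial)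
  also have "\<dots> = pochhammer (real (q - 1 + k) - real k + 1) k / fact k"
    by (rule gbinomial_pochhammer')
  also have "real (q - 1 + k) - real k + 1 = real q" using assms by simp
  finally show ?thesis by simp
qed

section \<open>Stirling's formula from Wallis' product\<close>

definition stirling_ratio :: "nat \<Rightarrow> real" where
  "stirling_ratio n = fact n / (sqrt (real n) * (real n / exp 1) ^ n)"

lemma stirling_ratio_pos: "n > 0 \<Longrightarrow> stirling_ratio n > 0"
  by (simp add: stirling_ratio_def)

lemma ln_stirling_ratio_diff:
  assumes "n > 0"
  shows "ln (stirling_ratio n) - ln (stirling_ratio (Suc n)) =
    (real n + 1/2) * (ln (real n + 1) - ln (real n)) - 1"
proof -
  have ln: "ln (stirling_ratio n) = ln (fact n) - (ln (real n) / 2 + real n * (ln (real n) - 1))" if "n > 0" for n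
    using that by (simp add: stirling_ratio_def ln_div ln_mult ln_sqrt ln_realpow)
  have "ln (fact (Suc n)) = ln (real n + 1) + ln (fact n)"
    by (simp add: ln_mult add.commute)
  then show ?thesis using assms by (simp add: ln field_simps)
qed

text \<open>The midpoint and trapezoidal rules for the integral of 1/t over [x, x + 1] bound the
  decrease from n to n + 1 between 0 and 1/(4n) - 1/(4(n + 1)). The upper bound telescopes, so the
  decreasing sequence is bounded below.\<close>

lemma ln_stirling_ratio_convergent: "convergent (\<lambda>n. ln (stirling_ratio (Suc n)))"
proof -
  have bounds: "ln (stirling_ratio (Suc (Suc n))) \<le> ln (stirling_ratio (Suc n))"
    "ln (stirling_ratio (Suc n)) - ln (stirling_ratio (Suc (Suc n))) \<le> 1 / (4 * real (Suc n)) - 1 / (4 * real (Suc (Suc n)))" for n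
  proof -
    define x where "x = real (Suc n)"
    have x: "x > 0" by (simp add: x_def)
    note diff = ln_stirling_ratio_diff[of "Suc n", folded x_def]
    have "2 / (2 * x + 1) \<le> ln (x + 1) - ln x"
      using ln_inverse_approx_ge[of x "x + 1"] x by (simp add: add.commute)
    then have "(x + 1/2) * (2 / (2 * x + 1)) \<le> (x + 1/2) * (ln (x + 1) - ln x)"
      using x by (intro mult_left_mono) auto
    moreover have "(x + 1/2) * (2 / (2 * x + 1)) = 1"
      using x by (simp add: field_simps)
    ultimately show "ln (stirling_ratio (Suc (Suc n))) \<le> ln (stirling_ratio (Suc n))" using diff by linarith
    have "(x + 1/2) * (ln (x + 1) - ln x) \<le> (x + 1/2) * (1 * (inverse x + inverse (x + 1)) / 2)"
      using ln_inverse_approx_le[of x 1] x by (intro mult_left_mono) auto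
    also have "\<dots> = 1 + (1 / (4 * x) - 1 / (4 * (x + 1)))"
      using x by (simp add: divide_simps) (simp add: algebra_simps)
    finally show "ln (stirling_ratio (Suc n)) - ln (stirling_ratio (Suc (Suc n))) \<le> 1 / (4 * real (Suc n)) - 1 / (4 * real (Suc (Suc n)))"
      using diff by (simp add: x_def add.commute)
  qed
  have dec: "decseq (\<lambda>n. ln (stirling_ratio (Suc n)))"
    by (rule decseq_SucI) (rule bounds(1))
  have "incseq (\<lambda>n. ln (stirling_ratio (Suc n)) - 1 / (4 * real (Suc n)))"
    by (rule incseq_SucI) (use bounds(2) in \<open>simp add: algebra_simps\<close>)
  then have low: "ln (stirling_ratio (Suc 0)) - 1 / 4 \<le> ln (stirling_ratio (Suc n)) - 1 / (4 * real (Suc n))" for n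
    by (auto dest: incseqD[of _ 0 n])
  have low': "ln (stirling_ratio (Suc 0)) - 1 / 4 \<le> ln (stirling_ratio (Suc n))" for n
  proof -
    have "0 \<le> 1 / (4 * real (Suc n))" by simp
    then show ?thesis using low[of n] by linarith
  qed
  have "Bseq (\<lambda>n. ln (stirling_ratio (Suc n)))"
    by (rule decseq_bounded[OF dec]) (use low' in blast)
  then show ?thesis using dec by (intro Bseq_monoseq_convergent decseq_imp_monoseq)
qed

lemma wallis_prod_eq:
  "(\<Prod>k=1..n. (4 * (real k)\<^sup>2) / (4 * (real k)\<^sup>2 - 1)) =
    (4 ^ n * (fact n)\<^sup>2 / fact (2 * n))\<^sup>2 / (2 * real n + 1)"
proof (induction n)
  case (Suc n)
  define Q where "Q n = (4 ^ n * (fact n)\<^sup>2 / fact (2 * n) :: real)" for n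
  define a where "a = real n"
  have a: "a \<ge> 0" by (simp add: a_def)
  have "(fact (2 * Suc n) :: real) = (2 * (a + 1)) * (2 * a + 1) * fact (2 * n)"
    by (simp add: a_def algebra_simps)
  then have "Q (Suc n) = (4 * (a + 1)\<^sup>2 * (4 ^ n * (fact n)\<^sup>2)) / ((2 * (a + 1)) * (2 * a + 1) * fact (2 * n))"
    by (simp add: Q_def a_def power_mult_distrib ac_simps)
  also have "\<dots> = (4 * (a + 1)\<^sup>2) / ((2 * (a + 1)) * (2 * a + 1)) * Q n"
    unfolding Q_def times_divide_times_eq ..
  also have "(4 * (a + 1)\<^sup>2) / ((2 * (a + 1)) * (2 * a + 1)) = 2 * (a + 1) / (2 * a + 1)"
    using a by (simp add: divide_simps power2_eq_square) (simp add: algebra_simps)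
  finally have Q: "Q (Suc n) = 2 * (a + 1) / (2 * a + 1) * Q n" .
  have "(\<Prod>k=1..Suc n. (4 * (real k)\<^sup>2) / (4 * (real k)\<^sup>2 - 1)) =
      (Q n)\<^sup>2 / (2 * a + 1) * ((4 * (a + 1)\<^sup>2) / (4 * (a + 1)\<^sup>2 - 1))"
    using Suc by (simp add: Q_def a_def add.commute)
  also have "4 * (a + 1)\<^sup>2 - 1 = (2 * a + 1) * (2 * a + 3)"
    by (simp add: power2_eq_square algebra_simps)
  also have "(Q n)\<^sup>2 / (2 * a + 1) * ((4 * (a + 1)\<^sup>2) / ((2 * a + 1) * (2 * a + 3))) =
      (2 * (a + 1) / (2 * a + 1) * Q n)\<^sup>2 / (2 * a + 3)"
  proof -
    have "q\<^sup>2 / d * ((4 * b\<^sup>2) / (d * e)) = (2 * b / d * q)\<^sup>2 / e" for q b d e :: real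
      by (simp add: power2_eq_square ac_simps)
    then show ?thesis .
  qed
  also have "2 * a + 3 = 2 * real (Suc n) + 1" by (simp add: a_def)
  finally show ?case unfolding Q[symmetric] unfolding Q_def .
qed simp

text \<open>Convergence of the logarithms gives a positive limit. Its value follows by comparing
  \<open>(stirling_ratio n)\<^sup>2\<close> with \<open>stirling_ratio (2 * n)\<close>: the powers
  of n/e cancel up to 4^n, and Wallis' product remains.\<close>

lemma stirling_ratio_tendsto: "stirling_ratio \<longlonglongrightarrow> sqrt (2 * pi)"
proof -
  obtain L where "(\<lambda>n. ln (stirling_ratio (Suc n))) \<longlonglongrightarrow> L"
    using ln_stirling_ratio_convergent by (auto simp: convergent_def)
  then have "(\<lambda>n. exp (ln (stirling_ratio (Suc n)))) \<longlonglongrightarrow> exp L" by (rule tendsto_exp)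
  then have "(\<lambda>n. stirling_ratio (Suc n)) \<longlonglongrightarrow> exp L" by (simp add: stirling_ratio_pos)
  then have lim: "stirling_ratio \<longlonglongrightarrow> exp L" by (simp only: filterlim_sequentially_Suc)
  have lim2: "(\<lambda>n. stirling_ratio (2 * n)) \<longlonglongrightarrow> exp L"
    by (rule filterlim_compose[OF lim]) (rule mult_nat_left_at_top, simp)
  have "(\<lambda>n. ((stirling_ratio n)\<^sup>2 / stirling_ratio (2 * n))\<^sup>2) \<longlonglongrightarrow> ((exp L)\<^sup>2 / exp L)\<^sup>2"
    by (intro tendsto_intros lim lim2) simp
  then have A: "(\<lambda>n. ((stirling_ratio n)\<^sup>2 / stirling_ratio (2 * n))\<^sup>2) \<longlonglongrightarrow> (exp L)\<^sup>2"
    by (simp add: power2_eq_square)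
  \<comment> \<open>The prefactor removes the denominator 2n + 1 of \<open>wallis_prod_eq\<close>
    and supplies the 2/n that the square roots leave in the squared ratio; it tends to 4.\<close>
  have "(\<lambda>n. (2 * (2 * real n + 1) / real n) * (\<Prod>k=1..n. (4 * (real k)\<^sup>2) / (4 * (real k)\<^sup>2 - 1))) \<longlonglongrightarrow> 4 * (pi / 2)"
    by (intro tendsto_mult wallis) real_asymp
  moreover have "eventually (\<lambda>n. (2 * (2 * real n + 1) / real n) * (\<Prod>k=1..n. (4 * (real k)\<^sup>2) / (4 * (real k)\<^sup>2 - 1)) =
      ((stirling_ratio n)\<^sup>2 / stirling_ratio (2 * n))\<^sup>2) sequentially"
    using eventually_gt_at_top[of 0]
  proof eventually_elim
    case (elim n)
    have "(real (2 * n) / exp 1) ^ (2 * n) = 4 ^ n * ((real n / exp 1) ^ n)\<^sup>2"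
      by (simp add: power_mult power_mult_distrib power_divide power2_eq_square)
    then have "(stirling_ratio n)\<^sup>2 / stirling_ratio (2 * n) =
        (4 ^ n * (fact n)\<^sup>2 / fact (2 * n)) * (sqrt (2 * real n) / real n)"
      using elim by (simp add: stirling_ratio_def power_mult_distrib power_divide field_simps)
    then have "((stirling_ratio n)\<^sup>2 / stirling_ratio (2 * n))\<^sup>2 =
        (4 ^ n * (fact n)\<^sup>2 / fact (2 * n))\<^sup>2 * (sqrt (2 * real n) / real n)\<^sup>2"
      by (simp only: power_mult_distrib)
    also have "(sqrt (2 * real n) / real n)\<^sup>2 = 2 / real n"
      using elim by (simp add: power_divide power2_eq_square)
    finally have eq: "((stirling_ratio n)\<^sup>2 / stirling_ratio (2 * n))\<^sup>2 =
        (4 ^ n * (fact n)\<^sup>2 / fact (2 * n))\<^sup>2 * (2 / real n)" .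
    have "2 * (2 * a + 1) / a * (X / (2 * a + 1)) = X * (2 / a)" if "a > 0" for a X :: real
      using that by (simp add: divide_simps)
    from this[of "real n"] show ?case unfolding wallis_prod_eq eq using elim by simp
  qed
  ultimately have "(\<lambda>n. ((stirling_ratio n)\<^sup>2 / stirling_ratio (2 * n))\<^sup>2) \<longlonglongrightarrow> 4 * (pi / 2)"
    by (rule Lim_transform_eventually)
  then have "(exp L)\<^sup>2 = 2 * pi" using A LIMSEQ_unique by fastforce
  then have "exp L = sqrt (2 * pi)" by (metis exp_ge_zero real_sqrt_unique)
  then show ?thesis using lim by simp
qed

section \<open>The limit\<close>

lemma fact_ratio_tendsto: "(\<lambda>N. fact (N + c) / (fact N * real N ^ c)) \<longlonglongrightarrow> 1"
proof (induction c)
  case (Suc c)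
  have "(\<lambda>N. real (N + Suc c) / real N) \<longlonglongrightarrow> 1" by real_asymp
  then have "(\<lambda>N. fact (N + c) / (fact N * real N ^ c) * (real (N + Suc c) / real N)) \<longlonglongrightarrow> 1 * 1"
    by (intro tendsto_mult Suc.IH)
  then show ?case by (simp add: mult_ac)
qed simp

text \<open>The factorials shifted by \<open>c i\<close> contribute N^(k + p(p - 1)/2) to the
  denominator, against N^k from \<open>fact (N * p + k)\<close>. The square roots contribute another
  N^((p - 1)/2) to the denominator, and p^k cancels.\<close>

lemma fact_term_tendsto:
  fixes c :: "nat \<Rightarrow> nat"
  assumes "p \<ge> 1" and c: "(\<Sum>i<p. c i) = k + (\<Sum>i<p. i)"
  shows "(\<lambda>N. real N powr (((real p)\<^sup>2 - 1) / 2) *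
     (fact (N * p + k) / (\<Prod>i<p. fact (N + c i)) / real p ^ (N * p + k)))
     \<longlonglongrightarrow> sqrt (real p) / sqrt (2 * pi) ^ (p - 1)"
proof -
  \<comment> \<open>For N > 0, \<open>?X N\<close> is the central multinomial probability (N p)! /
    ((N!)^p p^(N p)) times N^((p - 1)/2).\<close>
  let ?X = "\<lambda>N. stirling_ratio (N * p) / stirling_ratio N ^ p * sqrt (real p)"
  let ?F = "\<lambda>N. fact (N * p + k) / (fact (N * p) * real (N * p) ^ k) *
     (\<Prod>i<p. inverse (fact (N + c i) / (fact N * real N ^ c i))) * ?X N"
  have mult: "filterlim (\<lambda>N. N * p) sequentially sequentially"
    using assms(1) by (intro mult_nat_right_at_top) simp
  have lim: "?F \<longlonglongrightarrow> 1 * (\<Prod>i<p. inverse 1) * (sqrt (2 * pi) / sqrt (2 * pi) ^ p * sqrt (real p))"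
    by (intro tendsto_mult tendsto_prod tendsto_inverse tendsto_divide tendsto_power tendsto_const
        fact_ratio_tendsto stirling_ratio_tendsto
        filterlim_compose[OF stirling_ratio_tendsto mult] filterlim_compose[OF fact_ratio_tendsto mult]) auto
  have eq: "1 * (\<Prod>i<p. inverse 1) * (sqrt (2 * pi) / sqrt (2 * pi) ^ p * sqrt (real p)) =
      sqrt (real p) / sqrt (2 * pi) ^ (p - 1)"
    using assms(1) by (cases p) auto
  have "?F \<longlonglongrightarrow> sqrt (real p) / sqrt (2 * pi) ^ (p - 1)"
    using lim unfolding eq .
  moreover have "eventually (\<lambda>N. ?F N = real N powr (((real p)\<^sup>2 - 1) / 2) *
     (fact (N * p + k) / (\<Prod>i<p. fact (N + c i)) / real p ^ (N * p + k))) sequentially"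
    using eventually_gt_at_top[of 0]
  proof eventually_elim
    case (elim N)
    have p: "real p > 0" using assms(1) by simp
    have N: "real N > 0" using elim by simp
    have sqrt_pow: "sqrt (real N) ^ p = real N powr (real p / 2)"
      using N by (simp add: powr_half_sqrt[symmetric] powr_powr flip: powr_realpow)
    have "?X N = (fact (N * p) / (fact N ^ p * real p ^ (N * p))) * (sqrt (real N) ^ p / sqrt (real N))"
    proof -
      have "(real (N * p) / exp 1) ^ (N * p) = ((real N / exp 1) ^ N) ^ p * real p ^ (N * p)"
        by (simp add: power_mult[symmetric] power_mult_distrib[symmetric])
      then show ?thesis using p N
        by (simp add: stirling_ratio_def power_mult_distrib power_divide real_sqrt_mult)
    qed
    also have "sqrt (real N) ^ p / sqrt (real N) = real N powr ((real p - 1) / 2)"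
      unfolding sqrt_pow using N by (simp add: powr_half_sqrt[symmetric] powr_diff[symmetric] diff_divide_distrib)
    finally have X: "?X N = (fact (N * p) / (fact N ^ p * real p ^ (N * p))) * real N powr ((real p - 1) / 2)" .
    have "(\<Prod>i<p. inverse (fact (N + c i) / (fact N * real N ^ c i))) =
        fact N ^ p * real N ^ (k + (\<Sum>i<p. i)) / (\<Prod>i<p. fact (N + c i))"
      unfolding c[symmetric] by (simp add: prod_dividef prod.distrib power_sum)
    moreover have "real N powr (((real p)\<^sup>2 - 1) / 2) = real N ^ (\<Sum>i<p. i) * real N powr ((real p - 1) / 2)"
    proof -
      have "((real p)\<^sup>2 - 1) / 2 = real (\<Sum>i<p. i) + (real p - 1) / 2"
        using sum_real_lessThan[of p] by (simp add: field_simps)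
      then show ?thesis using N by (simp only: powr_add powr_realpow)
    qed
    ultimately show ?case unfolding X using p N
      by (simp add: power_add power_mult_distrib divide_simps)
  qed
  ultimately show ?thesis by (rule Lim_transform_eventually)
qed

lemma partitions_shift:
  assumes "p \<ge> 1"
  shows "bij_betw (\<lambda>\<mu> i. if i < p then \<mu> i + N else 0) (partitions p k)
    {\<nu> \<in> partitions p (N * p + k). N \<le> \<nu> (p - 1)}"
proof (rule bij_betw_byWitness[where f' = "\<lambda>\<nu> i. \<nu> i - N"])
  show "\<forall>\<mu>\<in>partitions p k. (\<lambda>i. (if i < p then \<mu> i + N else 0) - N) = \<mu>"
    by (auto simp: partitions_def fun_eq_iff)
  have ge: "N \<le> \<nu> i" if "\<nu> \<in> {\<nu> \<in> partitions p (N * p + k). N \<le> \<nu> (p - 1)}" "i < p" for \<nu> i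
  proof -
    have "\<nu> (p - 1) \<le> \<nu> i"
      by (rule lift_Suc_antimono_le[of \<nu>]) (use that in \<open>auto simp: partitions_def\<close>)
    then show ?thesis using that by simp
  qed
  then show "\<forall>\<nu>\<in>{\<nu> \<in> partitions p (N * p + k). N \<le> \<nu> (p - 1)}.
      (\<lambda>i. if i < p then \<nu> i - N + N else 0) = \<nu>"
    by (auto simp: partitions_def fun_eq_iff)
  show "(\<lambda>\<mu> i. if i < p then \<mu> i + N else 0) ` partitions p k \<subseteq>
      {\<nu> \<in> partitions p (N * p + k). N \<le> \<nu> (p - 1)}"
    using assms by (auto simp: partitions_def sum.distrib)
  show "(\<lambda>\<nu> i. \<nu> i - N) ` {\<nu> \<in> partitions p (N * p + k). N \<le> \<nu> (p - 1)} \<subseteq> partitions p k"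
  proof (rule image_subsetI)
    fix \<nu> assume \<nu>: "\<nu> \<in> {\<nu> \<in> partitions p (N * p + k). N \<le> \<nu> (p - 1)}"
    have "(\<Sum>i<p. \<nu> i - N) + N * p = (\<Sum>i<p. \<nu> i - N + N)"
      by (simp add: sum.distrib)
    also have "\<dots> = (\<Sum>i<p. \<nu> i)" using ge[OF \<nu>] by (intro sum.cong) auto
    finally have "(\<Sum>i<p. \<nu> i - N) = k" using \<nu> by (simp add: partitions_def)
    then show "(\<lambda>i. \<nu> i - N) \<in> partitions p k"
      using \<nu> by (auto simp: partitions_def diff_le_mono)
  qed
qed

text \<open>A shape accounts for \<open>syt_count\<close> times \<open>schur1\<close> words, and
  \<open>syt_count\<close> itself contains the factor \<open>schur1\<close>, hence the
  square.\<close>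

lemma card_words_last_part_ge:
  assumes "p \<ge> 1"
  shows "real (card {w \<in> words (N * p + k) p. N \<le> shape_part (rsk_shape w) p}) =
    (\<Sum>\<mu>\<in>partitions p k. fact (N * p + k) * (\<Prod>j<p. fact j) * (schur1 p \<mu>)\<^sup>2 /
       (\<Prod>i<p. fact (N + (\<mu> i + (p - 1 - i)))))"
proof -
  let ?n = "N * p + k"
  let ?P = "{\<nu> \<in> partitions p ?n. N \<le> \<nu> (p - 1)}"
  let ?shift = "\<lambda>\<mu> i. if i < p then \<mu> i + N else 0"
  have set_eq: "{w \<in> words ?n p. N \<le> shape_part (rsk_shape w) p} =
      (\<Union>\<nu>\<in>?P. {w \<in> words ?n p. word_pattern w p = \<nu>})"
    using word_pattern_in_gt_patterns assms by (auto simp: shape_part_rsk_shape)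
  have "card {w \<in> words ?n p. N \<le> shape_part (rsk_shape w) p} = (\<Sum>\<nu>\<in>?P. card {w \<in> words ?n p. word_pattern w p = \<nu>})"
    unfolding set_eq by (rule card_UN_disjoint) (auto simp: finite_partitions finite_words)
  then have "real (card {w \<in> words ?n p. N \<le> shape_part (rsk_shape w) p}) = (\<Sum>\<nu>\<in>?P. real (syt_count p ?n \<nu>) * schur1 p \<nu>)"
    by (simp add: card_words_with_shape)
  also have "\<dots> = (\<Sum>\<mu>\<in>partitions p k. real (syt_count p ?n (?shift \<mu>)) * schur1 p (?shift \<mu>))"
    by (rule sum.reindex_bij_betw[OF partitions_shift[OF assms], symmetric])
  also have "\<dots> = (\<Sum>\<mu>\<in>partitions p k. fact ?n * (\<Prod>j<p. fact j) * (schur1 p \<mu>)\<^sup>2 /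
       (\<Prod>i<p. fact (N + (\<mu> i + (p - 1 - i)))))"
  proof (intro sum.cong refl)
    fix \<mu> assume "\<mu> \<in> partitions p k"
    then have "?shift \<mu> \<in> partitions p ?n"
      using bij_betwE[OF partitions_shift[OF assms]] by blast
    moreover have "(\<Prod>i<p. fact (?shift \<mu> i + (p - 1 - i))) = (\<Prod>i<p. fact (N + (\<mu> i + (p - 1 - i))) :: real)"
      by (intro prod.cong refl) (simp add: add_ac)
    ultimately show "real (syt_count p ?n (?shift \<mu>)) * schur1 p (?shift \<mu>) =
      fact ?n * (\<Prod>j<p. fact j) * (schur1 p \<mu>)\<^sup>2 / (\<Prod>i<p. fact (N + (\<mu> i + (p - 1 - i))))"
      by (simp add: syt_count_formula schur1_shift power2_eq_square)
  qed
  finally show ?thesis .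
qed

lemma words_nonempty: "p \<ge> 1 \<Longrightarrow> words n p \<noteq> {}"
  using card_words[of n p] by auto

lemma prob_word_pmf:
  assumes "p \<ge> 1"
  shows "measure_pmf.prob (word_pmf n p) A = real (card {w \<in> words n p. w \<in> A}) / real p ^ n"
  unfolding word_pmf_def
  by (subst measure_pmf_of_set[OF words_nonempty[OF assms] finite_words])
    (simp add: card_words Int_def)

lemma prob_last_part_ge_tendsto:
  assumes "p \<ge> 1"
  shows "(\<lambda>N. real N powr (((real p)\<^sup>2 - 1) / 2) *
      (real (card {w \<in> words (N * p + k) p. N \<le> shape_part (rsk_shape w) p}) / real p ^ (N * p + k)))
    \<longlonglongrightarrow> sqrt (real p) * (\<Prod>j=1..p. fact (p - j)) / sqrt (2 * pi) ^ (p - 1) * real ((p\<^sup>2 - 1 + k) choose k)"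
proof -
  let ?L = "sqrt (real p) / sqrt (2 * pi) ^ (p - 1)"
  let ?c = "\<lambda>\<mu> i. \<mu> i + (p - 1 - i)"
  have lim: "(\<lambda>N. \<Sum>\<mu>\<in>partitions p k. (\<Prod>j<p. fact j) * (schur1 p \<mu>)\<^sup>2 *
      (real N powr (((real p)\<^sup>2 - 1) / 2) *
       (fact (N * p + k) / (\<Prod>i<p. fact (N + ?c \<mu> i)) / real p ^ (N * p + k))))
     \<longlonglongrightarrow> (\<Sum>\<mu>\<in>partitions p k. (\<Prod>j<p. fact j) * (schur1 p \<mu>)\<^sup>2 * ?L)"
  proof (intro tendsto_sum tendsto_mult_left fact_term_tendsto assms)
    fix \<mu> assume "\<mu> \<in> partitions p k"
    moreover have "(\<Sum>i<p. p - 1 - i) = (\<Sum>i<p. i)"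
      using sum.nat_diff_reindex[of "\<lambda>i. i" p] by simp
    ultimately show "(\<Sum>i<p. ?c \<mu> i) = k + (\<Sum>i<p. i)"
      unfolding sum.distrib by (simp add: partitions_def)
  qed
  have "(\<Sum>\<mu>\<in>partitions p k. (\<Prod>j<p. fact j) * (schur1 p \<mu>)\<^sup>2 * ?L) =
      (\<Prod>j<p. fact j) * (\<Sum>\<mu>\<in>partitions p k. (schur1 p \<mu>)\<^sup>2) * ?L"
    by (simp only: sum_distrib_left sum_distrib_right)
  also have "\<dots> = (\<Prod>j<p. fact j) * real ((p\<^sup>2 - 1 + k) choose k) * ?L"
    unfolding sum_schur1_sq[OF assms] ..
  finally have eq: "(\<Sum>\<mu>\<in>partitions p k. (\<Prod>j<p. fact j) * (schur1 p \<mu>)\<^sup>2 * ?L) =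
    (\<Prod>j<p. fact j) * real ((p\<^sup>2 - 1 + k) choose k) * ?L" .
  have fact_eq: "(\<Prod>j=1..p. fact (p - j)) = (\<Prod>j<p. fact j :: real)"
    by (rule prod.reindex_bij_witness[of _ "\<lambda>j. p - j" "\<lambda>j. p - j"]) auto
  have limit_eq: "sqrt (real p) * (\<Prod>j=1..p. fact (p - j)) / sqrt (2 * pi) ^ (p - 1) * real ((p\<^sup>2 - 1 + k) choose k) =
      (\<Sum>\<mu>\<in>partitions p k. (\<Prod>j<p. fact j) * (schur1 p \<mu>)\<^sup>2 * ?L)"
    unfolding eq fact_eq by simp
  have "x * (f * a * b / d / q) = a * b * (x * (f / d / q))" for x f a b d q :: real by simp
  then show ?thesis
    unfolding limit_eq using lim
    by (simp only: card_words_last_part_ge[OF assms] sum_divide_distrib sum_distrib_left)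
qed

text \<open>By \<open>incr_len_plus_chain_count\<close> the bound on \<open>incr_len\<close> says
  that there are at least \<open>N\<close> chains. For \<open>N \<ge> 1\<close> a chain exists and
  forces \<open>decr_len w = p\<close>; for \<open>N = 0\<close> this clause could fail.\<close>

lemma greene_event_iff:
  assumes "w \<in> words (N * p + k) p" "p \<ge> 1" "N \<ge> 1"
  shows "decr_len w = p \<and> incr_len (p - 1) w \<le> N * (p - 1) + k \<longleftrightarrow> N \<le> shape_part (rsk_shape w) p"
proof -
  have part: "shape_part (rsk_shape w) p = chain_count p w 1"
    using chain_count_eq_word_pattern[OF assms(1,2)] shape_part_rsk_shape[OF assms(1,2)] by simp
  have "N * p = N * (p - 1) + N" using assms(2) by (cases p) auto
  then have "incr_len (p - 1) w \<le> N * (p - 1) + k \<longleftrightarrow> N \<le> chain_count p w 1"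
    using incr_len_plus_chain_count[OF assms(1,2)] by linarith
  then show ?thesis
    using decr_len_eq[OF assms(1,2)] assms(3) part by auto
qed

theorem corollary1p3:
  fixes p k :: nat
  assumes "p \<ge> 1" and "k > 0"
  shows
    "((\<lambda>N. real N powr (((real p)\<^sup>2 - 1) / 2) *
         measure_pmf.prob (shape_pmf (N * p + k) p) {mu. shape_part mu p \<ge> N})
       \<longlonglongrightarrow> sqrt (real p) * (\<Prod>j=1..p. fact (p - j)) / (sqrt (2 * pi) ^ (p - 1) * fact k) *
           (\<integral>z. (z / 2) ^ k \<partial>chi_square (2 * p\<^sup>2)))
     \<and>
     ((\<lambda>N. real N powr (((real p)\<^sup>2 - 1) / 2) *
         measure_pmf.prob (word_pmf (N * p + k) p)
           {w. decr_len w = p \<and> incr_len (p - 1) w \<le> N * (p - 1) + k})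
       \<longlonglongrightarrow> sqrt (real p) * (\<Prod>j=1..p. fact (p - j)) / (sqrt (2 * pi) ^ (p - 1) * fact k) *
           (\<integral>z. (z / 2) ^ k \<partial>chi_square (2 * p\<^sup>2)))
     \<and>
     (\<lambda>N. measure_pmf.prob (word_pmf (N * p + k) p)
           {w. decr_len w = p \<and> incr_len (p - 1) w \<le> N * (p - 1) + k})
       \<sim>[sequentially]
     (\<lambda>N. sqrt (real p) * (\<Prod>j=1..p. fact (p - j)) / sqrt (2 * pi) ^ (p - 1) *
         real ((p\<^sup>2 - 1 + k) choose k) * (1 / real N) powr (((real p)\<^sup>2 - 1) / 2))"
proof -
  let ?\<alpha> = "((real p)\<^sup>2 - 1) / 2"
  let ?C = "sqrt (real p) * (\<Prod>j=1..p. fact (p - j)) / sqrt (2 * pi) ^ (p - 1) * real ((p\<^sup>2 - 1 + k) choose k)"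
  let ?Q = "\<lambda>N. measure_pmf.prob (word_pmf (N * p + k) p)
           {w. decr_len w = p \<and> incr_len (p - 1) w \<le> N * (p - 1) + k}"
  let ?R = "\<lambda>N. real (card {w \<in> words (N * p + k) p. N \<le> shape_part (rsk_shape w) p}) / real p ^ (N * p + k)"
  have const: "sqrt (real p) * (\<Prod>j=1..p. fact (p - j)) / (sqrt (2 * pi) ^ (p - 1) * fact k) *
           (\<integral>z. (z / 2) ^ k \<partial>chi_square (2 * p\<^sup>2)) = ?C"
  proof -
    have "p\<^sup>2 \<ge> 1" using assms(1) by simp
    then have "(\<integral>z. (z / 2) ^ k \<partial>chi_square (2 * p\<^sup>2)) = fact k * real (p\<^sup>2 - 1 + k choose k)"
      using pochhammer_of_nat_eq[of "p\<^sup>2" k] by (simp add: chi_square_moment)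
    then show ?thesis by simp
  qed
  have shape: "measure_pmf.prob (shape_pmf (N * p + k) p) {mu. shape_part mu p \<ge> N} = ?R N" for N
    unfolding shape_pmf_def measure_map_pmf prob_word_pmf[OF assms(1)] by simp
  have lim: "(\<lambda>N. real N powr ?\<alpha> * ?R N) \<longlonglongrightarrow> ?C"
    by (rule prob_last_part_ge_tendsto[OF assms(1)])
  have "eventually (\<lambda>N. ?R N = ?Q N) sequentially"
    using eventually_ge_at_top[of 1]
  proof eventually_elim
    case (elim N)
    then have "{w \<in> words (N * p + k) p. N \<le> shape_part (rsk_shape w) p} =
       {w \<in> words (N * p + k) p. w \<in> {w. decr_len w = p \<and> incr_len (p - 1) w \<le> N * (p - 1) + k}}"
      using greene_event_iff[of _ N p k] assms(1) by auto
    then show ?case by (simp only: prob_word_pmf[OF assms(1)])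
  qed
  then have "eventually (\<lambda>N. real N powr ?\<alpha> * ?R N = real N powr ?\<alpha> * ?Q N) sequentially"
    by eventually_elim simp
  then have lim': "(\<lambda>N. real N powr ?\<alpha> * ?Q N) \<longlonglongrightarrow> ?C"
    by (rule Lim_transform_eventually[OF lim])
  have "(p\<^sup>2 - 1 + k choose k) \<noteq> 0"
    using zero_less_binomial[of k "p\<^sup>2 - 1 + k"] by linarith
  then have C: "?C \<noteq> 0" using assms(1) by simp
  have "(\<lambda>N. ?Q N / (?C * (1 / real N) powr ?\<alpha>)) \<longlonglongrightarrow> 1"
  proof -
    have "(\<lambda>N. real N powr ?\<alpha> * ?Q N / ?C) \<longlonglongrightarrow> ?C / ?C"
      by (intro tendsto_divide lim' tendsto_const C)
    then have "(\<lambda>N. real N powr ?\<alpha> * ?Q N / ?C) \<longlonglongrightarrow> 1" using C by simp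
    moreover have "real N powr ?\<alpha> * ?Q N / ?C = ?Q N / (?C * (1 / real N) powr ?\<alpha>)" for N
      by (simp add: powr_divide field_simps)
    ultimately show ?thesis by simp
  qed
  then have "?Q \<sim>[sequentially] (\<lambda>N. ?C * (1 / real N) powr ?\<alpha>)"
    by (rule asymp_equivI')
  then show ?thesis unfolding const shape using lim lim' by blast
qed

end
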